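(* Let $X$ be a path-connected space, $x_0\in X$, and $H\leq\pi_1(X,x_0)$ a subgroup. Then $X$ has transfinite products relative to $H$ if and only if $H$ is $(P,p_\tau)$-closed.
   Context: A map is a continuous function; $f_{\#}$ denotes the homomorphism induced on fundamental groups. For paths, $\alpha\cdot\beta$ is concatenation and $\alpha^{-}(t)=\alpha(1-t)$. Closed subgroups: for a based space $(\mathbb{T},t_0)$, a subgroup $T\leq\pi_1(\mathbb{T},t_0)$ and $g\in\pi_1(\mathbb{T},t_0)$, a subgroup $H\leq\pi_1(X,x_0)$ is $(T,g)$-closed if for every map $f:(\mathbb{T},t_0)\to(X,x_0)$ with $f_{\#}(T)\leq H$ we have $f_{\#}(g)\in H$. The test space $\mathbb{H}^+$: let $C_n\subseteq\mathbb{R}^2$ be the circle of radius $\frac1n$ centered at $(\frac1n,0)$, $\mathbb{H}=\bigcup_{n\geq1}C_n$, $b_0=(0,0)$, and $\mathbb{H}^+=\mathbb{H}\cup([-1,0]\times\{0\})$ with basepoint $b_0^+=(-1,0)$. Let $\ell_n$ be the loop based at $b_0$ traversing $C_n$ once counterclockwise, $\iota:[0,1]\to\mathbb{H}^+$, $\iota(t)=(t-1,0)$, and $c_n=[\iota\cdot\ell_n\cdot\iota^{-}]\in\pi_1(\mathbb{H}^+,b_0^+)$. Let $\mathcal{C}\subseteq[0,1]$ be the standard middle third Cantor set and write $[0,1]\setminus\mathcal{C}=\bigcup_{n\geq1}\bigcup_{k=1}^{2^{n-1}}I_n^k$, where $I_n^k$ are the components of length $\frac{1}{3^n}$, indexed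 by $k$ in their natural order. Let $\ell_\tau:[0,1]\to\mathbb{H}$ be the loop with $\ell_\tau(\mathcal{C})=\{b_0\}$ and equal to $\ell_{2^{n-1}+k-1}$ (linearly reparametrized) on $\overline{I_n^k}$. Let $f_{odd},f_{even}:\mathbb{H}\to\mathbb{H}$ be the maps with $f_{odd}\circ\ell_n=\ell_{2n-1}$ and $f_{even}\circ\ell_n=\ell_{2n}$. Put $p_n=[\iota\cdot\ell_{2n-1}\cdot\ell_{2n}^{-}\cdot\iota^{-}]$, $P=\langle p_n\mid n\in\mathbb{N}\rangle\leq\pi_1(\mathbb{H}^+,b_0^+)$, and $p_\tau=[\iota\cdot(f_{odd}\circ\ell_\tau)\cdot(f_{even}\circ\ell_\tau)^{-}\cdot\iota^{-}]$. $X$ has transfinite products relative to $H$ if for every pair of maps $a,b:(\mathbb{H}^+,b_0^+)\to(X,x_0)$ such that $a\circ\iota=b\circ\iota$ and $Ha_{\#}(c_n)=Hb_{\#}(c_n)$ for all $n\in\mathbb{N}$, we have $Ha_{\#}(g)=Hb_{\#}(g)$ for all $g\in\pi_1(\mathbb{H}^+,b_0^+)$. *)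

theory Defs
  imports "HOL-Analysis.Analysis" "HOL-Algebra.Generated_Groups"
begin

section \<open>Fundamental groups and induced homomorphisms\<close>

text \<open>A topological space is a subset \<open>X\<close> of a type of class \<^class>\<open>topological_space\<close>, with the
  subspace topology. Paths are total functions on the reals, of which only the restriction to
  \<open>[0,1]\<close> matters; accordingly \<^const>\<open>homotopic_paths\<close> identifies functions agreeing on \<open>[0,1]\<close>.\<close>

definition based_loops :: "'a::topological_space set \<Rightarrow> 'a \<Rightarrow> (real \<Rightarrow> 'a) set" where
  "based_loops X x0 = {p. path p \<and> path_image p \<subseteq> X \<and> pathstart p = x0 \<and> pathfinish p = x0}"

definition path_class :: "'a::topological_space set \<Rightarrow> (real \<Rightarrow> 'a) \<Rightarrow> (real \<Rightarrow> 'a) set" where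
  "path_class X p = {q. homotopic_paths X p q}"

definition fundamental_group ::
    "'a::topological_space set \<Rightarrow> 'a \<Rightarrow> (real \<Rightarrow> 'a) set monoid" where
  "fundamental_group X x0 =
     \<lparr>carrier = path_class X ` based_loops X x0,
      monoid.mult = (\<lambda>A B. {r. \<exists>p\<in>A. \<exists>q\<in>B. homotopic_paths X (p +++ q) r}),
      one = path_class X (\<lambda>_. x0)\<rparr>"

definition based_map ::
    "'b::topological_space set \<Rightarrow> 'b \<Rightarrow> 'a::topological_space set \<Rightarrow> 'a \<Rightarrow> ('b \<Rightarrow> 'a) \<Rightarrow> bool" where
  "based_map T t0 X x0 f \<longleftrightarrow> continuous_on T f \<and> f \<in> T \<rightarrow> X \<and> f t0 = x0"

definition induced_hom ::
    "'a::topological_space set \<Rightarrow> ('b::topological_space \<Rightarrow> 'a) \<Rightarrow> (real \<Rightarrow> 'b) set \<Rightarrow> (real \<Rightarrow> 'a) set" where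
  "induced_hom X f A = {q. \<exists>p\<in>A. homotopic_paths X (f \<circ> p) q}"

definition closed_subgroup ::
    "'b::topological_space set \<Rightarrow> 'b \<Rightarrow> (real \<Rightarrow> 'b) set set \<Rightarrow> (real \<Rightarrow> 'b) set \<Rightarrow>
     'a::topological_space set \<Rightarrow> 'a \<Rightarrow> (real \<Rightarrow> 'a) set set \<Rightarrow> bool" where
  "closed_subgroup TT t0 T g X x0 H \<longleftrightarrow>
     (\<forall>f. based_map TT t0 X x0 f \<and> induced_hom X f ` T \<subseteq> H \<longrightarrow> induced_hom X f g \<in> H)"


section \<open>The Hawaiian earring with a whisker\<close>

definition earring_circle :: "nat \<Rightarrow> (real \<times> real) set" where
  "earring_circle n = sphere (1 / real n, 0) (1 / real n)"

definition earring :: "(real \<times> real) set" where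
  "earring = (\<Union>n\<in>{1..}. earring_circle n)"

definition earring_plus :: "(real \<times> real) set" where
  "earring_plus = earring \<union> {-1..0} \<times> {0}"

definition earring_plus_base :: "real \<times> real" where
  "earring_plus_base = (-1, 0)"

definition whisker :: "real \<Rightarrow> real \<times> real" where
  "whisker t = (t - 1, 0)"

text \<open>The point of \<open>C\<^sub>n\<close> at angle \<open>2\<pi>t + \<pi>\<close> as seen from its centre \<open>(1/n, 0)\<close>, so that the loop
  starts at the origin and runs counterclockwise.\<close>

definition ell :: "nat \<Rightarrow> real \<Rightarrow> real \<times> real" where
  "ell n t = ((1 - cos (2 * pi * t)) / real n, - sin (2 * pi * t) / real n)"

definition whisker_class :: "(real \<Rightarrow> real \<times> real) \<Rightarrow> (real \<Rightarrow> real \<times> real) set" where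
  "whisker_class p = path_class earring_plus (whisker +++ p +++ reversepath whisker)"

definition c_elt :: "nat \<Rightarrow> (real \<Rightarrow> real \<times> real) set" where
  "c_elt n = whisker_class (ell n)"


section \<open>The Cantor set and the transfinite loop\<close>

primrec cantor_stage :: "nat \<Rightarrow> real set" where
  "cantor_stage 0 = {0..1}"
| "cantor_stage (Suc n) = (\<lambda>x. x / 3) ` cantor_stage n \<union> (\<lambda>x. 2 / 3 + x / 3) ` cantor_stage n"

definition cantor_set :: "real set" where
  "cantor_set = (\<Inter>n. cantor_stage n)"

text \<open>For a gap \<open>I\<close>, that is, a component of \<open>[0,1] - \<C>\<close>, the numbers \<open>n = gap_level I\<close> and
  \<open>k = gap_rank I\<close> are those for which \<open>I\<close> is the interval \<open>I\<^sub>n\<^sup>k\<close>: the length of \<open>I\<close> is \<open>1 / 3\<^sup>n\<close>,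
  and \<open>I\<close> is the \<open>k\<close>-th gap of that length from the left, with \<open>k\<close> counted from 1.\<close>

definition cantor_gaps :: "real set set" where
  "cantor_gaps = components ({0..1} - cantor_set)"

definition gap_level :: "real set \<Rightarrow> nat" where
  "gap_level I = (THE n. Sup I - Inf I = 1 / 3 ^ n)"

definition gap_rank :: "real set \<Rightarrow> nat" where
  "gap_rank I = card {J \<in> cantor_gaps. gap_level J = gap_level I \<and> Inf J \<le> Inf I}"

text \<open>At the endpoints of a gap, the formula for its interior gives the origin as well, since all \<open>ell n\<close> start and
  end at the origin.\<close>

definition ell_tau :: "real \<Rightarrow> real \<times> real" where
  "ell_tau t =
     (if t \<in> {0..1} - cantor_set
      then let I = connected_component_set ({0..1} - cantor_set) t;
               n = gap_level I; k = gap_rank I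
           in ell (2 ^ (n - 1) + k - 1) ((t - Inf I) / (Sup I - Inf I))
      else (0, 0))"

text \<open>The self-map \<open>f\<close> of the earring determined by \<open>f \<circ> ell n = ell (\<phi> n)\<close> for all \<open>n \<ge> 1\<close>.\<close>

definition earring_map :: "(nat \<Rightarrow> nat) \<Rightarrow> real \<times> real \<Rightarrow> real \<times> real" where
  "earring_map \<phi> z = (THE w. \<exists>n\<ge>1. \<exists>t\<in>{0..1}. z = ell n t \<and> w = ell (\<phi> n) t)"

definition f_odd :: "real \<times> real \<Rightarrow> real \<times> real" where
  "f_odd = earring_map (\<lambda>n. 2 * n - 1)"

definition f_even :: "real \<times> real \<Rightarrow> real \<times> real" where
  "f_even = earring_map (\<lambda>n. 2 * n)"

definition p_elt :: "nat \<Rightarrow> (real \<Rightarrow> real \<times> real) set" where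
  "p_elt n = whisker_class (ell (2 * n - 1) +++ reversepath (ell (2 * n)))"

definition P_subgroup :: "(real \<Rightarrow> real \<times> real) set set" where
  "P_subgroup = generate (fundamental_group earring_plus earring_plus_base) (p_elt ` {1..})"

definition p_tau :: "(real \<Rightarrow> real \<times> real) set" where
  "p_tau = whisker_class ((f_odd \<circ> ell_tau) +++ reversepath (f_even \<circ> ell_tau))"


section \<open>Relative transfinite products\<close>

definition transfinite_products_rel ::
    "'a::topological_space set \<Rightarrow> 'a \<Rightarrow> (real \<Rightarrow> 'a) set set \<Rightarrow> bool" where
  "transfinite_products_rel X x0 H \<longleftrightarrow>
     (\<forall>a b. based_map earring_plus earring_plus_base X x0 a \<and>
            based_map earring_plus earring_plus_base X x0 b \<and>
            (\<forall>t\<in>{0..1}. a (whisker t) = b (whisker t)) \<and>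
            (\<forall>n\<ge>1. H #>\<^bsub>fundamental_group X x0\<^esub> induced_hom X a (c_elt n)
                  = H #>\<^bsub>fundamental_group X x0\<^esub> induced_hom X b (c_elt n)) \<longrightarrow>
            (\<forall>g\<in>carrier (fundamental_group earring_plus earring_plus_base).
                H #>\<^bsub>fundamental_group X x0\<^esub> induced_hom X a g
              = H #>\<^bsub>fundamental_group X x0\<^esub> induced_hom X b g))"

end

theory Submission
  imports Defs
begin

text \<open>
  The link between the two properties is the map that places one null family of loops on the odd circles of
  the earring and another one on the even circles. Under such a map, \<open>p_elt n\<close> becomes the quotient of the \<open>n\<close>-th
  members of the two families and \<open>p_tau\<close> becomes the quotient of their infinite products in
  the order of the gaps of the Cantor set.

  If \<open>X\<close> has transfinite products relative to \<open>H\<close> and \<open>f\<close> maps \<open>P_subgroup\<close> into \<open>H\<close>, then composing \<open>f\<close>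
  with the inclusions of the odd and of the even circles gives two maps that agree modulo \<open>H\<close> on each
  \<open>c_elt n\<close>. They therefore agree on the class of \<open>ell_tau\<close>, which means that \<open>f\<close> sends \<open>p_tau\<close> into \<open>H\<close>
  (\<open>transfinite_products_imp_closed\<close>).

  For the converse, closedness is first put into the form of \<open>closed_subgroup_gapwise\<close>: two loops that
  are at the base point on the whole Cantor set and differ by an element of \<open>H\<close> on each gap differ by an
  element of \<open>H\<close>. Loops that are constant on all but two gaps already show that \<open>H\<close> is normal
  (\<open>closed_subgroup_normal\<close>). An arbitrary loop in the earring is at the origin on a closed set \<open>K\<close> of times. A
  monotone reparametrization sends the Cantor set into \<open>K\<close> and each gap of the Cantor set to a gap of \<open>K\<close> or
  to a point (\<open>earring_loop_fit\<close>), so that afterwards the loop makes at most one excursion from the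
  origin on each gap. An excursion stays on a single circle and is homotopic to one turn around it,
  to the inverse of that, or to a constant (\<open>circle_excursion_homotopic\<close>). Two maps \<open>a\<close> and \<open>b\<close> that agree
  modulo \<open>H\<close> on the classes \<open>c_elt n\<close> agree on the excursions as well, where normality of \<open>H\<close> takes care of
  the inverses, and the gapwise criterion extends the agreement to the whole loop
  (\<open>closed_imp_transfinite_products\<close>).
\<close>

section \<open>Fundamental groups and induced homomorphisms\<close>

lemma based_loopsI:
  "path p \<Longrightarrow> path_image p \<subseteq> X \<Longrightarrow> pathstart p = x \<Longrightarrow> pathfinish p = x \<Longrightarrow> p \<in> based_loops X x"
  by (simp add: based_loops_def)

lemma based_loopsD:
  assumes "p \<in> based_loops X x"
  shows "path p" "path_image p \<subseteq> X" "pathstart p = x" "pathfinish p = x"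
  using assms by (auto simp: based_loops_def)

lemma based_loops_join: "p \<in> based_loops X x \<Longrightarrow> q \<in> based_loops X x \<Longrightarrow> p +++ q \<in> based_loops X x"
  by (simp add: based_loops_def subset_path_image_join)

lemma based_loops_reversepath: "p \<in> based_loops X x \<Longrightarrow> reversepath p \<in> based_loops X x"
  by (simp add: based_loops_def)

lemma based_loops_const: "x \<in> X \<Longrightarrow> (\<lambda>_. x) \<in> based_loops X x"
  by (auto simp: based_loops_def path_def path_image_def pathstart_def pathfinish_def)

lemma based_loops_homotopic:
  "p \<in> based_loops X x \<Longrightarrow> homotopic_paths X p q \<Longrightarrow> q \<in> based_loops X x"
  by (metis based_loopsD(3,4) based_loopsI homotopic_paths_imp_path homotopic_paths_imp_pathfinish
      homotopic_paths_imp_pathstart homotopic_paths_imp_subset)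

lemma based_loops_image:
  assumes "p \<in> based_loops T t" "continuous_on T f" "f \<in> T \<rightarrow> X" "f t = x"
  shows "f \<circ> p \<in> based_loops X x"
  using assms unfolding based_loops_def
  by (auto intro!: path_continuous_image continuous_on_subset[of T f]
      simp: path_image_compose pathstart_compose pathfinish_compose)

text \<open>Two reparametrizations with the same ends are homotopic by the straight line in the convex set
  \<open>[0,1]\<close>, and composing with \<open>p\<close> moves that homotopy into \<open>X\<close>. The unit and inverse laws below are
  instances, because both sides of each law are reparametrizations of one path; this works in every
  topological space.\<close>

lemma homotopic_paths_precompose:
  assumes p: "path p" "path_image p \<subseteq> X"
    and \<sigma>: "path \<sigma>" "path_image \<sigma> \<subseteq> {0..1}" and \<tau>: "path \<tau>" "path_image \<tau> \<subseteq> {0..1}"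
    and ends: "pathstart \<tau> = pathstart \<sigma>" "pathfinish \<tau> = pathfinish \<sigma>"
  shows "homotopic_paths X (p \<circ> \<sigma>) (p \<circ> \<tau>)"
proof (rule homotopic_paths_continuous_image)
  show "homotopic_paths {0..1} \<sigma> \<tau>"
    using \<sigma> \<tau> ends by (intro homotopic_paths_linear closed_segment_subset) (auto simp: path_image_def subset_eq)
  show "continuous_on {0..1} p" "p \<in> {0..1} \<rightarrow> X"
    using p by (auto simp: path_def path_image_def)
qed

lemma path_id01: "path (\<lambda>t::real. t)" "path_image (\<lambda>t::real. t) = {0..1}"
  "pathstart (\<lambda>t::real. t) = 0" "pathfinish (\<lambda>t::real. t) = 1"
  by (auto simp: path_def path_image_def pathstart_def pathfinish_def intro!: continuous_intros)

lemma path_const: "path (\<lambda>_. x)" "path_image (\<lambda>_. x) = {x}" "pathstart (\<lambda>_. x) = x" "pathfinish (\<lambda>_. x) = x"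
  by (auto simp: path_def path_image_def pathstart_def pathfinish_def)

lemma homotopic_paths_join_const:
  assumes "path p" "path_image p \<subseteq> X" "pathfinish p = x"
  shows "homotopic_paths X (p +++ (\<lambda>_. x)) p"
proof -
  have "homotopic_paths X (p \<circ> ((\<lambda>t. t) +++ (\<lambda>_. 1))) (p \<circ> (\<lambda>t. t))"
    using assms by (intro homotopic_paths_precompose) (auto simp: path_id01 path_const subset_path_image_join)
  moreover have "p \<circ> ((\<lambda>t. t) +++ (\<lambda>_. 1)) = p +++ (\<lambda>_. x)"
    using assms by (auto simp: joinpaths_def fun_eq_iff pathfinish_def)
  ultimately show ?thesis by (simp add: comp_def)
qed

lemma homotopic_paths_const_join:
  assumes "path p" "path_image p \<subseteq> X" "pathstart p = x"
  shows "homotopic_paths X ((\<lambda>_. x) +++ p) p"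
proof -
  have "homotopic_paths X (p \<circ> ((\<lambda>_. 0) +++ (\<lambda>t. t))) (p \<circ> (\<lambda>t. t))"
    using assms by (intro homotopic_paths_precompose) (auto simp: path_id01 path_const subset_path_image_join)
  moreover have "p \<circ> ((\<lambda>_. 0) +++ (\<lambda>t. t)) = (\<lambda>_. x) +++ p"
    using assms by (auto simp: joinpaths_def fun_eq_iff pathstart_def)
  ultimately show ?thesis by (simp add: comp_def)
qed

lemma homotopic_paths_join_reversepath:
  assumes "path p" "path_image p \<subseteq> X" "pathstart p = x"
  shows "homotopic_paths X (p +++ reversepath p) (\<lambda>_. x)"
proof -
  have "homotopic_paths X (p \<circ> ((\<lambda>t. t) +++ reversepath (\<lambda>t. t))) (p \<circ> (\<lambda>_. 0))"
    using assms by (intro homotopic_paths_precompose) (auto simp: path_id01 path_const subset_path_image_join)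
  moreover have "p \<circ> ((\<lambda>t. t) +++ reversepath (\<lambda>t. t)) = p +++ reversepath p"
    using assms by (auto simp: joinpaths_def reversepath_def fun_eq_iff pathstart_def)
  ultimately show ?thesis using assms by (simp add: comp_def pathstart_def)
qed

lemma homotopic_paths_reversepath_join:
  assumes "path p" "path_image p \<subseteq> X" "pathfinish p = x"
  shows "homotopic_paths X (reversepath p +++ p) (\<lambda>_. x)"
  using homotopic_paths_join_reversepath[of "reversepath p" X x] assms by simp

lemma path_class_eq: "homotopic_paths X p q \<Longrightarrow> path_class X p = path_class X q"
  unfolding path_class_def using homotopic_paths_sym homotopic_paths_trans by blast

lemma carrier_fundamental_group: "carrier (fundamental_group X x) = path_class X ` based_loops X x"
  by (simp add: fundamental_group_def)

lemma one_fundamental_group: "\<one>\<^bsub>fundamental_group X x\<^esub> = path_class X (\<lambda>_. x)"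
  by (simp add: fundamental_group_def)

lemma path_class_carrier: "p \<in> based_loops X x \<Longrightarrow> path_class X p \<in> carrier (fundamental_group X x)"
  by (simp add: carrier_fundamental_group)

lemma mult_path_class:
  assumes "p \<in> based_loops X x" "q \<in> based_loops X x"
  shows "path_class X p \<otimes>\<^bsub>fundamental_group X x\<^esub> path_class X q = path_class X (p +++ q)"
proof -
  have "homotopic_paths X (p' +++ q') r \<Longrightarrow> homotopic_paths X (p +++ q) r"
    if "homotopic_paths X p p'" "homotopic_paths X q q'" for p' q' r
    using that assms by (metis based_loopsD(3,4) homotopic_paths_join homotopic_paths_trans)
  moreover have "homotopic_paths X p p" "homotopic_paths X q q"
    using assms by (auto simp: based_loops_def)
  ultimately show ?thesis
    unfolding fundamental_group_def path_class_def by (simp, blast)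
qed

lemma group_fundamental_group:
  assumes "x \<in> X"
  shows "group (fundamental_group X x)"
proof (rule Group.groupI)
  let ?G = "fundamental_group X x"
  show "A \<otimes>\<^bsub>?G\<^esub> B \<in> carrier ?G" if "A \<in> carrier ?G" "B \<in> carrier ?G" for A B
    using that by (auto simp: carrier_fundamental_group mult_path_class based_loops_join)
  show "\<one>\<^bsub>?G\<^esub> \<in> carrier ?G"
    using assms by (simp add: one_fundamental_group path_class_carrier based_loops_const)
  show "A \<otimes>\<^bsub>?G\<^esub> B \<otimes>\<^bsub>?G\<^esub> C = A \<otimes>\<^bsub>?G\<^esub> (B \<otimes>\<^bsub>?G\<^esub> C)"
    if ABC: "A \<in> carrier ?G" "B \<in> carrier ?G" "C \<in> carrier ?G" for A B C
  proof -
    from ABC obtain p q r where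
      p: "p \<in> based_loops X x" "A = path_class X p" and q: "q \<in> based_loops X x" "B = path_class X q"
      and r: "r \<in> based_loops X x" "C = path_class X r"
      by (auto simp: carrier_fundamental_group)
    have "path_class X (p +++ q +++ r) = path_class X ((p +++ q) +++ r)"
      using p(1) q(1) r(1) by (intro path_class_eq homotopic_paths_assoc) (auto simp: based_loops_def)
    then show ?thesis using p q r by (simp add: mult_path_class based_loops_join)
  qed
  show "\<one>\<^bsub>?G\<^esub> \<otimes>\<^bsub>?G\<^esub> A = A" "\<exists>B\<in>carrier ?G. B \<otimes>\<^bsub>?G\<^esub> A = \<one>\<^bsub>?G\<^esub>"
    if A: "A \<in> carrier ?G" for A
  proof -
    from A obtain p where p: "p \<in> based_loops X x" "A = path_class X p"
      by (auto simp: carrier_fundamental_group)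
    have "path_class X ((\<lambda>_. x) +++ p) = path_class X p"
      "path_class X (reversepath p +++ p) = path_class X (\<lambda>_. x)"
      using based_loopsD[OF p(1)]
      by (simp_all add: path_class_eq homotopic_paths_const_join homotopic_paths_reversepath_join)
    then have "\<one>\<^bsub>?G\<^esub> \<otimes>\<^bsub>?G\<^esub> A = A" "path_class X (reversepath p) \<otimes>\<^bsub>?G\<^esub> A = \<one>\<^bsub>?G\<^esub>"
      using p assms
      by (simp_all add: one_fundamental_group mult_path_class based_loops_const based_loops_reversepath)
    then show "\<one>\<^bsub>?G\<^esub> \<otimes>\<^bsub>?G\<^esub> A = A" "\<exists>B\<in>carrier ?G. B \<otimes>\<^bsub>?G\<^esub> A = \<one>\<^bsub>?G\<^esub>"
      using p path_class_carrier based_loops_reversepath by blast+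
  qed
qed

lemma inv_path_class:
  assumes "p \<in> based_loops X x"
  shows "inv\<^bsub>fundamental_group X x\<^esub> (path_class X p) = path_class X (reversepath p)"
proof -
  have "x \<in> X" using assms by (auto simp: based_loops_def)
  interpret group "fundamental_group X x" by (rule group_fundamental_group) fact
  have "homotopic_paths X (reversepath p +++ p) (\<lambda>_. x)"
    using based_loopsD[OF assms] by (intro homotopic_paths_reversepath_join)
  then show ?thesis
    using assms
    by (intro inv_equality)
       (simp_all add: one_fundamental_group mult_path_class based_loops_reversepath path_class_carrier path_class_eq)
qed

lemma induced_hom_path_class:
  assumes f: "based_map T t X x f" and p: "p \<in> based_loops T t"
  shows "induced_hom X f (path_class T p) = path_class X (f \<circ> p)"
proof -
  have "homotopic_paths X (f \<circ> p) (f \<circ> q)" if "homotopic_paths T p q" for q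
    using that f by (auto simp: based_map_def intro: homotopic_paths_continuous_image)
  moreover have "homotopic_paths T p p" using p by (simp add: based_loops_def)
  ultimately show ?thesis
    unfolding induced_hom_def path_class_def using homotopic_paths_trans by blast
qed

lemma induced_hom_carrier:
  assumes f: "based_map T t X x f" and A: "A \<in> carrier (fundamental_group T t)"
  shows "induced_hom X f A \<in> carrier (fundamental_group X x)"
  using assms based_loops_image[of _ T t f X x]
  by (auto simp: carrier_fundamental_group induced_hom_path_class based_map_def)

lemma induced_hom_hom:
  assumes f: "based_map T t X x f"
  shows "induced_hom X f \<in> hom (fundamental_group T t) (fundamental_group X x)"
proof (rule homI)
  fix A B assume "A \<in> carrier (fundamental_group T t)" "B \<in> carrier (fundamental_group T t)"
  then obtain p q where "p \<in> based_loops T t" "q \<in> based_loops T t" "A = path_class T p" "B = path_class T q"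
    by (auto simp: carrier_fundamental_group)
  then show "induced_hom X f (A \<otimes>\<^bsub>fundamental_group T t\<^esub> B)
      = induced_hom X f A \<otimes>\<^bsub>fundamental_group X x\<^esub> induced_hom X f B"
    using f based_loops_image[of _ T t f X x]
    by (simp add: mult_path_class induced_hom_path_class[OF f] based_loops_join path_compose_join based_map_def)
qed (rule induced_hom_carrier[OF f])

section \<open>Lassos\<close>

text \<open>A lasso runs out along a tail \<open>\<omega>\<close>, around a loop at the far end, and back. Once the tail is fixed,
  lassos turn concatenation and reversal of loops at the far end into multiplication and inversion in
  the fundamental group at the near end, so that statements about \<open>c_elt\<close>, \<open>p_elt\<close> and \<open>p_tau\<close>
  become statements about loops at the origin.\<close>

definition lasso :: "'a::topological_space set \<Rightarrow> (real \<Rightarrow> 'a) \<Rightarrow> (real \<Rightarrow> 'a) \<Rightarrow> (real \<Rightarrow> 'a) set" where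
  "lasso X \<omega> p = path_class X (\<omega> +++ p +++ reversepath \<omega>)"

lemma whisker_class_lasso: "whisker_class = lasso earring_plus whisker"
  by (simp add: whisker_class_def lasso_def fun_eq_iff)

locale tail =
  fixes X :: "'a::topological_space set" and x y :: 'a and \<omega> :: "real \<Rightarrow> 'a"
  assumes path_tail: "path \<omega>" and tail_image: "path_image \<omega> \<subseteq> X"
    and tail_start: "pathstart \<omega> = x" and tail_finish: "pathfinish \<omega> = y"
begin

lemma start_in: "x \<in> X" and finish_in: "y \<in> X"
  using tail_image tail_start tail_finish by (auto simp: path_image_def pathstart_def pathfinish_def)

sublocale G: group "fundamental_group X x"
  by (rule group_fundamental_group[OF start_in])

lemma lasso_loop: "p \<in> based_loops X y \<Longrightarrow> \<omega> +++ p +++ reversepath \<omega> \<in> based_loops X x"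
  using path_tail tail_image tail_start tail_finish
  by (simp add: based_loops_def subset_path_image_join)

lemma lasso_carrier: "p \<in> based_loops X y \<Longrightarrow> lasso X \<omega> p \<in> carrier (fundamental_group X x)"
  by (simp add: lasso_def path_class_carrier lasso_loop)

lemma lasso_cong:
  assumes "homotopic_paths X p q" "p \<in> based_loops X y"
  shows "lasso X \<omega> p = lasso X \<omega> q"
  unfolding lasso_def using assms path_tail tail_image tail_finish
  by (intro path_class_eq homotopic_paths_join) (auto simp: based_loops_def)

lemma lasso_const: "lasso X \<omega> (\<lambda>_. y) = \<one>\<^bsub>fundamental_group X x\<^esub>"
  unfolding lasso_def one_fundamental_group
proof (rule path_class_eq)
  have "homotopic_paths X (\<omega> +++ (\<lambda>_. y) +++ reversepath \<omega>) (\<omega> +++ reversepath \<omega>)"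
    using path_tail tail_image tail_finish
    by (intro homotopic_paths_join homotopic_paths_const_join) (auto simp: path_const)
  also have "homotopic_paths X \<dots> (\<lambda>_. x)"
    using path_tail tail_image tail_start by (rule homotopic_paths_join_reversepath)
  finally show "homotopic_paths X (\<omega> +++ (\<lambda>_. y) +++ reversepath \<omega>) (\<lambda>_. x)" .
qed

text \<open>The way back along the first tail cancels against the way out along the second one.\<close>

lemma lasso_join:
  assumes p: "p \<in> based_loops X y" and q: "q \<in> based_loops X y"
  shows "lasso X \<omega> (p +++ q) = lasso X \<omega> p \<otimes>\<^bsub>fundamental_group X x\<^esub> lasso X \<omega> q"
proof -
  let ?r = "reversepath \<omega>"
  note t = path_tail tail_image tail_start tail_finish
  note P = based_loopsD[OF p] and Q = based_loopsD[OF q]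
  note [simp] = t P Q subset_path_image_join
  have "homotopic_paths X (?r +++ \<omega> +++ q +++ ?r) ((?r +++ \<omega>) +++ q +++ ?r)"
    by (rule homotopic_paths_assoc) auto
  also have "homotopic_paths X \<dots> ((\<lambda>_. y) +++ q +++ ?r)"
    by (intro homotopic_paths_join homotopic_paths_reversepath_join) auto
  also have "homotopic_paths X \<dots> (q +++ ?r)"
    by (intro homotopic_paths_const_join) auto
  finally have 1: "homotopic_paths X (?r +++ \<omega> +++ q +++ ?r) (q +++ ?r)" .
  have "homotopic_paths X ((\<omega> +++ p +++ ?r) +++ \<omega> +++ q +++ ?r) (\<omega> +++ (p +++ ?r) +++ \<omega> +++ q +++ ?r)"
    by (rule homotopic_paths_sym[OF homotopic_paths_assoc]) auto
  also have "homotopic_paths X \<dots> (\<omega> +++ p +++ ?r +++ \<omega> +++ q +++ ?r)"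
    by (intro homotopic_paths_join homotopic_paths_sym[OF homotopic_paths_assoc]) auto
  also have "homotopic_paths X \<dots> (\<omega> +++ p +++ q +++ ?r)"
    by (intro homotopic_paths_join 1) auto
  also have "homotopic_paths X \<dots> (\<omega> +++ (p +++ q) +++ ?r)"
    by (intro homotopic_paths_join homotopic_paths_assoc) auto
  finally show ?thesis
    unfolding lasso_def using lasso_loop[OF p] lasso_loop[OF q]
    by (simp add: mult_path_class path_class_eq)
qed

lemma lasso_reversepath:
  assumes p: "p \<in> based_loops X y"
  shows "lasso X \<omega> (reversepath p) = inv\<^bsub>fundamental_group X x\<^esub> lasso X \<omega> p"
proof -
  have "reversepath (\<omega> +++ p +++ reversepath \<omega>) = (\<omega> +++ reversepath p) +++ reversepath \<omega>"
    using based_loopsD[OF p] tail_finish by (simp add: reversepath_joinpaths)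
  moreover have "homotopic_paths X (\<omega> +++ reversepath p +++ reversepath \<omega>) \<dots>"
    using based_loopsD[OF p] path_tail tail_image tail_finish by (intro homotopic_paths_assoc) auto
  ultimately show ?thesis
    unfolding lasso_def using lasso_loop[OF p] by (simp add: inv_path_class path_class_eq)
qed

lemma lasso_join_reversepath:
  assumes "p \<in> based_loops X y" "q \<in> based_loops X y"
  shows "lasso X \<omega> (p +++ reversepath q)
       = lasso X \<omega> p \<otimes>\<^bsub>fundamental_group X x\<^esub> inv\<^bsub>fundamental_group X x\<^esub> lasso X \<omega> q"
  using assms by (simp add: lasso_join lasso_reversepath based_loops_reversepath)

end

lemma tail_image_map:
  assumes "tail T t s \<nu>" "based_map T t X x f"
  shows "tail X x (f s) (f \<circ> \<nu>)"
proof -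
  interpret tail T t s \<nu> by fact
  show ?thesis
    using assms(2) path_tail tail_image tail_start tail_finish
    by unfold_locales (auto simp: based_map_def path_image_compose pathstart_compose pathfinish_compose
        intro!: path_continuous_image continuous_on_subset[of T f])
qed

lemma induced_hom_lasso:
  assumes "tail T t s \<nu>" "based_map T t X x f" "p \<in> based_loops T s"
  shows "induced_hom X f (lasso T \<nu> p) = lasso X (f \<circ> \<nu>) (f \<circ> p)"
  unfolding lasso_def
  using induced_hom_path_class[OF assms(2) tail.lasso_loop[OF assms(1,3)]]
  by (simp add: path_compose_join path_compose_reversepath)

lemma path_class_cong:
  assumes "\<And>t. t \<in> {0..1} \<Longrightarrow> p t = q t"
  shows "path_class X p = path_class X q"
proof -
  have "homotopic_paths X p r \<longleftrightarrow> homotopic_paths X q r" for r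
    unfolding homotopic_paths using assms by (simp add: pathstart_def pathfinish_def)
  then show ?thesis by (simp add: path_class_def)
qed

lemma lasso_cong_on:
  assumes "\<And>t. t \<in> {0..1} \<Longrightarrow> p t = q t" "\<And>t. t \<in> {0..1} \<Longrightarrow> \<omega> t = \<nu> t"
  shows "lasso X \<omega> p = lasso X \<nu> q"
  unfolding lasso_def using assms by (intro path_class_cong) (auto simp: joinpaths_def reversepath_def)

lemma rcoset_eq_iff:
  assumes "group G" "subgroup H G" "x \<in> carrier G" "y \<in> carrier G"
  shows "H #>\<^bsub>G\<^esub> x = H #>\<^bsub>G\<^esub> y \<longleftrightarrow> x \<otimes>\<^bsub>G\<^esub> inv\<^bsub>G\<^esub> y \<in> H"
proof -
  interpret group G by fact
  have "x \<in> H #>\<^bsub>G\<^esub> y \<longleftrightarrow> x \<otimes>\<^bsub>G\<^esub> inv\<^bsub>G\<^esub> y \<in> H"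
    using assms by (intro subgroup.rcos_module) auto
  moreover have "H #>\<^bsub>G\<^esub> x = H #>\<^bsub>G\<^esub> y \<longleftrightarrow> x \<in> H #>\<^bsub>G\<^esub> y"
    using assms repr_independence[of x H y] rcos_self[of x H] by auto
  ultimately show ?thesis by simp
qed

section \<open>Maps out of the earring with a whisker\<close>

lemma mem_earring_circle:
  assumes "n \<ge> 1"
  shows "(u, v) \<in> earring_circle n \<longleftrightarrow> real n * (u\<^sup>2 + v\<^sup>2) = 2 * u"
proof -
  have n: "real n > 0" using assms by simp
  have "(u, v) \<in> earring_circle n \<longleftrightarrow> sqrt ((1 / real n - u)\<^sup>2 + v\<^sup>2) = 1 / real n"
    by (simp add: earring_circle_def dist_prod_def dist_real_def)
  also have "\<dots> \<longleftrightarrow> (1 / real n - u)\<^sup>2 + v\<^sup>2 = (1 / real n)\<^sup>2"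
    using n by (smt (verit) real_sqrt_unique real_sqrt_pow2 zero_le_power2 divide_nonneg_nonneg)
  also have "\<dots> \<longleftrightarrow> u\<^sup>2 + v\<^sup>2 = 2 * u / real n"
    by (auto simp: power2_diff algebra_simps)
  also have "\<dots> \<longleftrightarrow> real n * (u\<^sup>2 + v\<^sup>2) = 2 * u"
    using n by (auto simp: field_simps)
  finally show ?thesis .
qed

lemma ell_in_circle: "n \<ge> 1 \<Longrightarrow> ell n t \<in> earring_circle n"
proof -
  assume n: "n \<ge> 1"
  define c where "c = cos (2 * pi * t)"
  define s where "s = sin (2 * pi * t)"
  have "c\<^sup>2 + s\<^sup>2 = 1" by (simp add: c_def s_def)
  then have "(1 - c)\<^sup>2 + s\<^sup>2 = 2 * (1 - c)" by (simp add: power2_eq_square algebra_simps)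
  then have "real n * (((1 - c) / n)\<^sup>2 + (- s / n)\<^sup>2) = 2 * ((1 - c) / n)"
    using n by (simp add: power_divide add_divide_distrib[symmetric]) (simp add: power2_eq_square field_simps)
  then show ?thesis
    unfolding ell_def mem_earring_circle[OF n] c_def s_def by simp
qed

lemma ell_image: "n \<ge> 1 \<Longrightarrow> ell n ` {0..1} = earring_circle n"
proof (intro equalityI subsetI)
  fix z assume n: "n \<ge> 1" and z: "z \<in> earring_circle n"
  obtain u v where uv: "z = (u, v)" by (cases z)
  have "real n * (u\<^sup>2 + v\<^sup>2) = 2 * u" using z n uv by (simp add: mem_earring_circle)
  then have "(1 - n * u)\<^sup>2 + (- (n * v))\<^sup>2 = 1"
    by (simp add: power2_eq_square algebra_simps) (metis distrib_left mult.left_commute)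
  then obtain t where t: "0 \<le> t" "t < 2 * pi" "1 - n * u = cos t" "- (n * v) = sin t"
    using sincos_total_2pi by metis
  have "z = ell n (t / (2 * pi))"
    using n t(3,4)[symmetric] by (simp add: ell_def uv)
  then show "z \<in> ell n ` {0..1}" using t(1,2) by auto
qed (auto simp: ell_in_circle)

lemma ell_0 [simp]: "ell n 0 = (0, 0)" and ell_1 [simp]: "ell n 1 = (0, 0)"
  by (auto simp: ell_def)

lemma ell_eq_0_iff:
  assumes "n \<ge> 1" "t \<in> {0..1}"
  shows "ell n t = (0, 0) \<longleftrightarrow> t = 0 \<or> t = 1"
proof
  assume "ell n t = (0, 0)"
  then have "cos (2 * pi * t) = 1" using assms by (simp add: ell_def)
  then obtain k :: int where "2 * pi * t = k * 2 * pi" by (auto simp: cos_one_2pi_int)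
  then have "t = k" by simp
  then show "t = 0 \<or> t = 1" using assms by auto
qed auto

text \<open>A point other than the origin determines its circle, because a point \<open>(u, v)\<close> of \<open>C\<^sub>n\<close> satisfies
  \<open>n * (u\<^sup>2 + v\<^sup>2) = 2 * u\<close>, and then it determines its parameter up to an integer.\<close>

lemma ell_eq_cases:
  assumes "ell n s = ell m t" "n \<ge> 1" "m \<ge> 1" "s \<in> {0..1}" "t \<in> {0..1}"
  shows "n = m \<and> s = t \<or> s \<in> {0, 1} \<and> t \<in> {0, 1}"
proof (cases "s \<in> {0, 1}")
  case True
  then have "ell m t = (0, 0)" using assms(1) by auto
  then show ?thesis using True assms ell_eq_0_iff[of m t] by auto
next
  case False
  then have ne: "ell n s \<noteq> (0, 0)" using ell_eq_0_iff assms by auto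
  obtain u v where uv: "ell n s = (u, v)" by (cases "ell n s")
  have "real n * (u\<^sup>2 + v\<^sup>2) = 2 * u" "real m * (u\<^sup>2 + v\<^sup>2) = 2 * u"
    using assms(1-3) uv ell_in_circle[of n s] ell_in_circle[of m t] by (metis mem_earring_circle)+
  moreover have "u\<^sup>2 + v\<^sup>2 \<noteq> 0" using ne uv by (auto simp: sum_power2_eq_zero_iff)
  ultimately have nm: "n = m" by (metis mult_cancel_right of_nat_eq_iff)
  with assms have "sin (2 * pi * s) = sin (2 * pi * t) \<and> cos (2 * pi * s) = cos (2 * pi * t)"
    by (auto simp: ell_def)
  then obtain k :: int where "2 * pi * s = 2 * pi * t + 2 * pi * k"
    by (auto simp: sin_cos_eq_iff)
  then have "2 * pi * s = 2 * pi * (t + k)" by (simp add: algebra_simps)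
  then have k: "s = t + k" by simp
  have "\<bar>real_of_int k\<bar> < 1" using k False assms by auto
  then have "k = 0" by linarith
  then show ?thesis using k nm by simp
qed

lemma path_ell: "path (ell n)"
  unfolding path_def ell_def by (cases "n = 0") (auto intro!: continuous_intros)

lemma earring_circle_subset: "n \<ge> 1 \<Longrightarrow> earring_circle n \<subseteq> earring"
  by (auto simp: earring_def)

lemma ell_in_earring: "n \<ge> 1 \<Longrightarrow> ell n t \<in> earring"
  using ell_in_circle earring_circle_subset by blast

lemma earring_subset_plus: "earring \<subseteq> earring_plus"
  by (auto simp: earring_plus_def)

lemma ell_loop:
  assumes "n \<ge> 1"
  shows "ell n \<in> based_loops earring (0, 0)"
  using assms by (auto simp: based_loops_def path_ell path_image_def pathstart_def pathfinish_def ell_in_earring)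

lemma origin_in_earring: "(0, 0) \<in> earring"
  using ell_in_earring[of 1 0] by simp

lemma earring_circle_subset_cball: "n \<ge> 1 \<Longrightarrow> earring_circle n \<subseteq> cball (0, 0) (2 / real n)"
proof
  fix z assume n: "n \<ge> 1" and "z \<in> earring_circle n"
  then have "dist (1 / real n, 0) z = 1 / n" by (simp add: earring_circle_def)
  moreover have "dist (0, 0) (1 / real n, 0::real) = 1 / n" by (simp add: dist_prod_def)
  ultimately show "z \<in> cball (0, 0) (2 / real n)"
    using dist_triangle[of "(0, 0)" z "(1 / real n, 0)"] by simp
qed

text \<open>The circles shrink to the origin: the set is the intersection over \<open>N\<close> of the closed sets formed
  by the \<open>A n\<close> with \<open>n < N\<close> and a closed ball of radius \<open>2 / N\<close> that swallows all the others.\<close>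

lemma closed_Union_earring_subsets:
  assumes "\<And>n. n \<ge> 1 \<Longrightarrow> closed (A n)" "\<And>n. n \<ge> 1 \<Longrightarrow> A n \<subseteq> earring_circle n"
  shows "closed (insert (0, 0) (\<Union>n\<in>{1..}. A n))"
proof -
  have "insert (0, 0) (\<Union>n\<in>{1..}. A n) = (\<Inter>N\<in>{1..}. (\<Union>n\<in>{1..<N}. A n) \<union> cball (0, 0) (2 / real N))"
    (is "?L = ?R")
  proof (intro equalityI subsetI)
    fix z assume "z \<in> ?L"
    moreover have "z \<in> cball (0, 0) (2 / real N)" if "z \<in> A n" "N \<le> n" "N \<ge> 1" for n N
    proof -
      have "z \<in> cball (0, 0) (2 / real n)" using that assms(2)[of n] earring_circle_subset_cball[of n] by auto
      moreover have "2 / real n \<le> 2 / real N" using that by (intro divide_left_mono) auto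
      ultimately show ?thesis by simp
    qed
    ultimately have "z \<in> (\<Union>n\<in>{1..<N}. A n) \<or> z \<in> cball (0, 0) (2 / real N)" if "N \<ge> 1" for N
      using that by (cases "z = (0, 0)") (auto, metis not_le atLeastLessThan_iff)
    then show "z \<in> ?R" by blast
  next
    fix z assume z: "z \<in> ?R"
    show "z \<in> ?L"
    proof (cases "z = (0, 0)")
      case False
      then have "dist (0, 0) z > 0" by simp
      then obtain N where N: "N \<noteq> 0" "inverse (real N) < dist (0, 0) z / 2"
        using ex_inverse_of_nat_less[of "dist (0, 0) z / 2"] by auto
      then have "z \<notin> cball (0, 0) (2 / real N)" by (simp add: inverse_eq_divide)
      then show ?thesis using z N(1) by (auto simp: Suc_le_eq)
    qed simp
  qed
  moreover have "closed ?R"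
    using assms(1) by (intro closed_INT ballI closed_Un closed_UN) auto
  ultimately show ?thesis by simp
qed

lemma whisker_image: "whisker ` {0..1} = {-1..0} \<times> {0}"
proof (intro equalityI subsetI)
  fix z :: "real \<times> real" assume "z \<in> {-1..0} \<times> {0}"
  then have "z = whisker (fst z + 1)" "fst z + 1 \<in> {0..1}" by (auto simp: whisker_def)
  then show "z \<in> whisker ` {0..1}" by blast
qed (auto simp: whisker_def)

lemma closed_earring_plus: "closed earring_plus"
proof -
  have "closed (insert (0, 0) (\<Union>n\<in>{1..}. earring_circle n))"
    by (rule closed_Union_earring_subsets) (auto simp: earring_circle_def)
  moreover have "insert (0, 0) (\<Union>n\<in>{1..}. earring_circle n) = earring"
    using origin_in_earring by (auto simp: earring_def)
  ultimately have "closed earring" by simp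
  then show "closed earring_plus"
    unfolding earring_plus_def by (intro closed_Un closed_Times) auto
qed

lemma path_whisker: "path whisker"
  unfolding path_def whisker_def by (intro continuous_intros)

lemma tail_whisker: "tail earring_plus earring_plus_base (0, 0) whisker"
  by unfold_locales
    (auto simp: path_whisker earring_plus_base_def pathstart_def pathfinish_def path_image_def
      whisker_image earring_plus_def, auto simp: whisker_def)

text \<open>Uniform convergence to the constant \<open>y\<close>, phrased with neighbourhoods because the target need not
  be metric. This is what loops on the circles must satisfy to fit together continuously at the origin.\<close>

definition null_family :: "'a::topological_space \<Rightarrow> (nat \<Rightarrow> real \<Rightarrow> 'a) \<Rightarrow> bool" where
  "null_family y \<mu> \<longleftrightarrow> (\<forall>U. open U \<longrightarrow> y \<in> U \<longrightarrow> (\<exists>N. \<forall>n\<ge>N. \<mu> n ` {0..1} \<subseteq> U))"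

text \<open>A map on the earring with its whisker is the same as a path and a null family of loops at its end.
  For continuity, the preimage of a closed set \<open>F\<close> is a union of images of compact sets, one for the
  whisker and one for each circle. If \<open>y \<in> F\<close>, the union contains the origin and is closed because the circles
  shrink; if \<open>y \<notin> F\<close>, only finitely many circles contribute.\<close>

lemma glue_on_earring_plus:
  assumes "tail X x y \<omega>"
    and loops: "\<And>n. n \<ge> 1 \<Longrightarrow> \<mu> n \<in> based_loops X y"
    and null: "null_family y \<mu>"
  obtains f where "based_map earring_plus earring_plus_base X x f"
    "\<And>t. t \<in> {0..1} \<Longrightarrow> f (whisker t) = \<omega> t"
    "\<And>n t. n \<ge> 1 \<Longrightarrow> t \<in> {0..1} \<Longrightarrow> f (ell n t) = \<mu> n t"
proof -
  interpret tail X x y \<omega> by fact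
  define rel where "rel z nt = (fst nt \<ge> 1 \<and> snd nt \<in> {0..1} \<and> z = ell (fst nt) (snd nt))" for z and nt :: "nat \<times> real"
  define f where "f z = (if z \<in> whisker ` {0..1} then \<omega> (fst z + 1)
      else let nt = SOME nt. rel z nt in \<mu> (fst nt) (snd nt))" for z
  have f_whisker: "f (whisker t) = \<omega> t" if "t \<in> {0..1}" for t
    using that by (auto simp: f_def whisker_def)
  have f_ell: "f (ell n t) = \<mu> n t" if nt: "n \<ge> 1" "t \<in> {0..1}" for n t
  proof (cases "ell n t \<in> whisker ` {0..1}")
    case True
    then have "ell n t = (0, 0)" using cos_le_one[of "2 * pi * t"] nt(1)
      by (auto simp: whisker_image ell_def zero_le_divide_iff divide_le_0_iff)
    then have "t = 0 \<or> t = 1" using nt by (simp add: ell_eq_0_iff)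
    moreover have "f (0, 0) = y"
      using f_whisker[of 1] tail_finish by (simp add: whisker_def pathfinish_def)
    ultimately show ?thesis using based_loopsD(3,4)[OF loops[OF nt(1)]]
      by (auto simp: pathstart_def pathfinish_def)
  next
    case False
    define nt' where "nt' = (SOME nt. rel (ell n t) nt)"
    have "rel (ell n t) (n, t)" using nt by (simp add: rel_def)
    then have r: "rel (ell n t) nt'" unfolding nt'_def by (rule someI)
    have "f (ell n t) = \<mu> (fst nt') (snd nt')" using False by (simp add: f_def nt'_def Let_def)
    also have "\<dots> = \<mu> n t"
    proof -
      have "t \<notin> {0, 1}"
        using False by (auto simp: whisker_image)
      then show ?thesis using ell_eq_cases[of n t "fst nt'" "snd nt'"] r nt by (auto simp: rel_def)
    qed
    finally show ?thesis .
  qed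
  have cover: "earring_plus = whisker ` {0..1} \<union> (\<Union>n\<in>{1..}. ell n ` {0..1})"
    using ell_image by (auto simp: earring_plus_def earring_def whisker_image)
  have "continuous_on earring_plus f"
    unfolding continuous_on_closed_vimage[OF closed_earring_plus]
  proof (intro allI impI)
    fix F :: "'a set" assume F: "closed F"
    define W where "W = whisker ` ({0..1} \<inter> \<omega> -` F)"
    define A where "A n = ell n ` ({0..1} \<inter> \<mu> n -` F)" for n
    have eq: "f -` F \<inter> earring_plus = W \<union> (\<Union>n\<in>{1..}. A n)"
      unfolding cover W_def A_def by (auto simp: f_whisker f_ell)
    have compact_part: "compact (p ` ({0..1} \<inter> q -` F))" if "path p" "path q"
      for p :: "real \<Rightarrow> real \<times> real" and q :: "real \<Rightarrow> 'a"
    proof (rule compact_continuous_image)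
      have "closed ({0..1} \<inter> q -` F)"
        using that(2) F by (subst Int_commute, intro closed_vimage_Int) (auto simp: path_def)
      then show "compact ({0..1} \<inter> q -` F)" by (auto simp: compact_eq_bounded_closed intro: bounded_subset[of "{0..1}"])
      show "continuous_on ({0..1} \<inter> q -` F) p" using that(1) unfolding path_def by (rule continuous_on_subset) auto
    qed
    have W: "closed W" unfolding W_def by (intro compact_imp_closed compact_part path_whisker path_tail)
    have A: "closed (A n)" if "n \<ge> 1" for n
      unfolding A_def using loops[OF that] by (intro compact_imp_closed compact_part path_ell) (auto dest: based_loopsD)
    show "closed (f -` F \<inter> earring_plus)"
    proof (cases "y \<in> F")
      case True
      then have "(0, 0) \<in> W"
        using tail_finish by (auto simp: W_def whisker_def pathfinish_def intro!: image_eqI[of _ _ 1])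
      then have "f -` F \<inter> earring_plus = W \<union> insert (0, 0) (\<Union>n\<in>{1..}. A n)"
        using eq by auto
      moreover have "closed (insert (0, 0) (\<Union>n\<in>{1..}. A n))"
        using A by (rule closed_Union_earring_subsets) (auto simp: A_def ell_in_circle)
      ultimately show ?thesis using closed_Un[OF W] by metis
    next
      case False
      then obtain N where "\<And>n. n \<ge> N \<Longrightarrow> \<mu> n ` {0..1} \<subseteq> - F"
        using null F unfolding null_family_def by (metis ComplI open_Compl)
      then have "A n = {}" if "n \<ge> N" for n using that by (force simp: A_def)
      then have "n < N" if "z \<in> A n" for n z using that by (metis empty_iff not_le)
      then have "(\<Union>n\<in>{1..}. A n) = (\<Union>n\<in>{1..<N}. A n)"
        by fastforce
      then show ?thesis unfolding eq using W A by (auto intro!: closed_Un closed_UN)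
    qed
  qed
  moreover have "f \<in> earring_plus \<rightarrow> X"
    unfolding cover using f_whisker f_ell tail_image loops
    by (auto simp: based_loops_def path_image_def subset_iff) 
  moreover have "f earring_plus_base = x"
    using f_whisker[of 0] tail_start by (simp add: whisker_def earring_plus_base_def pathstart_def)
  ultimately show ?thesis using that[of f] f_whisker f_ell by (simp add: based_map_def)
qed

section \<open>The gaps of the Cantor set\<close>

text \<open>The left end points of the gaps of length \<open>1 / 3\<^sup>n\<close>. By self-similarity of the Cantor set, the gaps
  below the top level are copies of larger gaps, scaled into the two outer thirds.\<close>

fun gap_starts :: "nat \<Rightarrow> real set" where
  "gap_starts 0 = {}"
| "gap_starts (Suc 0) = {1 / 3}"
| "gap_starts (Suc (Suc n)) = (\<lambda>x. x / 3) ` gap_starts (Suc n) \<union> (\<lambda>x. 2 / 3 + x / 3) ` gap_starts (Suc n)"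

abbreviation gap :: "nat \<Rightarrow> real \<Rightarrow> real set" where
  "gap n l \<equiv> {l<..<l + 1 / 3 ^ n}"

lemma finite_gap_starts: "finite (gap_starts n)"
  by (induction n rule: gap_starts.induct) auto

lemma card_gap_starts: "card (gap_starts (Suc n)) \<le> 2 ^ n"
proof (induction n)
  case (Suc n)
  have "card (gap_starts (Suc (Suc n))) \<le> card (gap_starts (Suc n)) + card (gap_starts (Suc n))"
    unfolding gap_starts.simps
    by (intro order_trans[OF card_Un_le] add_mono card_image_le finite_gap_starts)
  then show ?case using Suc by simp
qed simp

lemma mem_image_left: "t \<in> (\<lambda>x. x / 3) ` A \<longleftrightarrow> 3 * t \<in> A" for t :: real
proof -
  have "t = x / 3 \<longleftrightarrow> x = 3 * t" for x by auto
  then show ?thesis by (simp add: image_iff)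
qed

lemma mem_image_right: "t \<in> (\<lambda>x. 2 / 3 + x / 3) ` A \<longleftrightarrow> 3 * t - 2 \<in> A" for t :: real
proof -
  have "t = 2 / 3 + x / 3 \<longleftrightarrow> x = 3 * t - 2" for x by (simp add: field_simps) linarith
  then show ?thesis by (simp add: image_iff)
qed

lemma mem_cantor_stage_Suc: "t \<in> cantor_stage (Suc n) \<longleftrightarrow> 3 * t \<in> cantor_stage n \<or> 3 * t - 2 \<in> cantor_stage n"
  by (simp add: mem_image_left mem_image_right)

lemma mem_gap_starts_Suc:
  "l \<in> gap_starts (Suc (Suc n)) \<longleftrightarrow> 3 * l \<in> gap_starts (Suc n) \<or> 3 * l - 2 \<in> gap_starts (Suc n)"
  by (simp add: mem_image_left mem_image_right)

lemma one_div_power_Suc: "1 / 3 ^ Suc n = (1 / 3 ^ n) / (3::real)"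
  by simp

lemma gap_starts_range: "l \<in> gap_starts n \<Longrightarrow> 0 \<le> l \<and> l + 1 / 3 ^ n \<le> 1"
proof (induction n arbitrary: l rule: gap_starts.induct)
  case (3 n)
  have "3 * l + 1 / 3 ^ Suc n \<le> 1 \<and> 0 \<le> 3 * l \<or> 3 * l - 2 + 1 / 3 ^ Suc n \<le> 1 \<and> 0 \<le> 3 * l - 2"
    using "3.prems"(1) "3.IH"(1)[of "3 * l"] "3.IH"(1)[of "3 * l - 2"] unfolding mem_gap_starts_Suc by blast
  moreover have "3 * (1 / 3 ^ Suc (Suc n)) = (1 / 3 ^ Suc n :: real)" "(0::real) < 1 / 3 ^ Suc n" by simp_all
  ultimately show ?case by linarith
qed auto

lemma cantor_stage_subset: "cantor_stage n \<subseteq> {0..1}"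
proof (induction n)
  case (Suc n)
  show ?case
  proof
    fix t assume "t \<in> cantor_stage (Suc n)"
    then have "3 * t \<in> {0..1} \<or> 3 * t - 2 \<in> {0..1}" using Suc unfolding mem_cantor_stage_Suc by blast
    then show "t \<in> {0..1}" by auto
  qed
qed simp

lemma cantor_stage_Suc_left: "t < 2 / 3 \<Longrightarrow> t \<in> cantor_stage (Suc n) \<longleftrightarrow> 3 * t \<in> cantor_stage n"
  using cantor_stage_subset[of n] unfolding mem_cantor_stage_Suc by fastforce

lemma cantor_stage_Suc_right: "t > 1 / 3 \<Longrightarrow> t \<in> cantor_stage (Suc n) \<longleftrightarrow> 3 * t - 2 \<in> cantor_stage n"
  using cantor_stage_subset[of n] unfolding mem_cantor_stage_Suc by fastforce

lemma cantor_set_iff: "t \<in> cantor_set \<longleftrightarrow> (\<forall>n. t \<in> cantor_stage (Suc n))"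
proof -
  have "t \<in> cantor_stage (Suc 0) \<Longrightarrow> t \<in> cantor_stage 0"
    using cantor_stage_subset[of "Suc 0"] by (simp only: cantor_stage.simps(1)) blast
  then have "(\<forall>n. t \<in> cantor_stage n) \<longleftrightarrow> (\<forall>n. t \<in> cantor_stage (Suc n))"
    by (metis not0_implies_Suc)
  then show ?thesis by (simp add: cantor_set_def del: cantor_stage.simps)
qed

lemma cantor_set_subset: "cantor_set \<subseteq> {0..1}"
  unfolding cantor_set_def using cantor_stage_subset by blast

lemma cantor_set_left: "t < 2 / 3 \<Longrightarrow> t \<in> cantor_set \<longleftrightarrow> 3 * t \<in> cantor_set"
  by (simp only: cantor_set_iff[of t] cantor_stage_Suc_left) (simp add: cantor_set_def)

lemma cantor_set_right: "t > 1 / 3 \<Longrightarrow> t \<in> cantor_set \<longleftrightarrow> 3 * t - 2 \<in> cantor_set"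
  by (simp only: cantor_set_iff[of t] cantor_stage_Suc_right) (simp add: cantor_set_def)

lemma cantor_set_middle: "t \<in> {1/3<..<2/3} \<Longrightarrow> t \<notin> cantor_set"
  using cantor_set_left[of t] cantor_set_subset by auto

lemma zero_one_in_cantor_set: "0 \<in> cantor_set" "1 \<in> cantor_set"
proof -
  have "0 \<in> cantor_stage n \<and> 1 \<in> cantor_stage n" for n
    by (induction n) (auto simp: image_iff intro!: bexI[of _ 0] bexI[of _ 1])
  then show "0 \<in> cantor_set" "1 \<in> cantor_set" by (auto simp: cantor_set_def)
qed

lemma closed_cantor_set: "closed cantor_set"
proof -
  have "closed (cantor_stage n)" for n
  proof (induction n)
    case (Suc n)
    have "compact (cantor_stage n)"
      using Suc cantor_stage_subset[of n] by (auto simp: compact_eq_bounded_closed intro: bounded_subset[of "{0..1}"])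
    then show ?case
      by (auto intro!: closed_Un compact_imp_closed compact_continuous_image continuous_intros)
  qed simp
  then show ?thesis by (simp add: cantor_set_def closed_INT)
qed

lemma gap_starts_cases:
  assumes "l \<in> gap_starts (Suc (Suc n))"
  obtains (left) "3 * l \<in> gap_starts (Suc n)" "l + 1 / 3 ^ Suc (Suc n) \<le> 1 / 3"
    | (right) "3 * l - 2 \<in> gap_starts (Suc n)" "l \<ge> 2 / 3"
  using assms gap_starts_range[of "3 * l" "Suc n"] gap_starts_range[of "3 * l - 2" "Suc n"]
  unfolding mem_gap_starts_Suc one_div_power_Suc[of "Suc n"] by fastforce

lemma gap_ends_in_cantor_set:
  "l \<in> gap_starts n \<Longrightarrow> l \<in> cantor_set \<and> l + 1 / 3 ^ n \<in> cantor_set"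
proof (induction n arbitrary: l rule: gap_starts.induct)
  case 2
  then have l: "l = 1 / 3" by simp
  show ?case
    unfolding l using zero_one_in_cantor_set cantor_set_left[of "1/3"] cantor_set_right[of "2/3"] by simp
next
  case (3 n)
  let ?e = "1 / 3 ^ Suc (Suc n) :: real"
  have e: "3 * ?e = 1 / 3 ^ Suc n" "?e > 0" by simp_all
  from "3.prems"(1) show ?case
  proof (cases rule: gap_starts_cases)
    case left
    then have "3 * l \<in> cantor_set" "3 * (l + ?e) \<in> cantor_set"
      using "3.IH"(1)[of "3 * l"] e(1) by (simp_all add: distrib_left)
    moreover have "l < 2 / 3" "l + ?e < 2 / 3" using left e(2) by linarith+
    ultimately show ?thesis using cantor_set_left by blast
  next
    case right
    then have "3 * l - 2 \<in> cantor_set" "3 * (l + ?e) - 2 \<in> cantor_set"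
      using "3.IH"(1)[of "3 * l - 2"] e(1) by (simp_all add: algebra_simps)
    moreover have "l > 1 / 3" "l + ?e > 1 / 3" using right e(2) by linarith+
    ultimately show ?thesis using cantor_set_right by blast
  qed
qed simp

lemma gap_disjoint_cantor_set:
  "l \<in> gap_starts n \<Longrightarrow> t \<in> gap n l \<Longrightarrow> t \<notin> cantor_set"
proof (induction n arbitrary: l t rule: gap_starts.induct)
  case 2
  then have "t \<in> {1/3<..<2/3}" by simp
  then show ?case by (rule cantor_set_middle)
next
  case (3 n)
  let ?e = "1 / 3 ^ Suc (Suc n) :: real"
  have e: "3 * ?e = 1 / 3 ^ Suc n" by simp
  have t: "l < t" "t < l + ?e" using "3.prems"(2) by simp_all
  from "3.prems"(1) show ?case
  proof (cases rule: gap_starts_cases)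
    case left
    have "3 * t \<in> gap (Suc n) (3 * l)"
      unfolding greaterThanLessThan_iff using t e by (intro conjI) linarith+
    then show ?thesis using left "3.IH"(1)[of "3 * l" "3 * t"] t cantor_set_left[of t] by auto
  next
    case right
    have "3 * t - 2 \<in> gap (Suc n) (3 * l - 2)"
      unfolding greaterThanLessThan_iff using t e by (intro conjI) linarith+
    then show ?thesis using right "3.IH"(1)[of "3 * l - 2" "3 * t - 2"] t cantor_set_right[of t] by auto
  qed
qed simp

lemma gap_exists:
  assumes "t \<in> {0..1} - cantor_set"
  obtains n l where "l \<in> gap_starts n" "t \<in> gap n l"
proof -
  have third: "3 * (1 / 3 ^ Suc (Suc m)) = (1 / 3 ^ Suc m :: real)" for m by simp
  have "\<exists>m l. l \<in> gap_starts (Suc m) \<and> t \<in> gap (Suc m) l" if "t \<in> {0..1}" "t \<notin> cantor_stage n" for n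
    using that
  proof (induction n arbitrary: t)
    case (Suc n)
    consider "t \<le> 1 / 3" | "t \<in> {1/3<..<2/3}" | "t \<ge> 2 / 3" by force
    then show ?case
    proof cases
      case 1
      then have "3 * t \<in> {0..1}" "3 * t \<notin> cantor_stage n" using Suc.prems cantor_stage_Suc_left[of t n] by auto
      then obtain m l where ml: "l \<in> gap_starts (Suc m)" "3 * t \<in> gap (Suc m) l" using Suc.IH by blast
      then have "l / 3 \<in> gap_starts (Suc (Suc m))" unfolding mem_gap_starts_Suc by simp
      moreover have "t \<in> gap (Suc (Suc m)) (l / 3)"
        using ml(2) third[of m] unfolding greaterThanLessThan_iff by (intro conjI) linarith+
      ultimately show ?thesis by blast
    next
      case 2
      then show ?thesis by (intro exI[of _ 0] exI[of _ "1/3"]) auto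
    next
      case 3
      then have "3 * t - 2 \<in> {0..1}" "3 * t - 2 \<notin> cantor_stage n"
        using Suc.prems cantor_stage_Suc_right[of t n] by auto
      then obtain m l where ml: "l \<in> gap_starts (Suc m)" "3 * t - 2 \<in> gap (Suc m) l" using Suc.IH by blast
      then have "2 / 3 + l / 3 \<in> gap_starts (Suc (Suc m))"
        unfolding mem_gap_starts_Suc by (simp add: algebra_simps)
      moreover have "t \<in> gap (Suc (Suc m)) (2 / 3 + l / 3)"
        using ml(2) third[of m] unfolding greaterThanLessThan_iff by (intro conjI) linarith+
      ultimately show ?thesis by blast
    qed
  qed simp
  moreover from assms obtain n where "t \<notin> cantor_stage n" by (auto simp: cantor_set_def)
  ultimately show ?thesis using that assms by blast
qed

lemma gap_starts_0_iff: "l \<in> gap_starts n \<Longrightarrow> n \<noteq> 0"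
  by (cases n) auto

text \<open>The gap is connected and misses the Cantor set, and a larger interval would contain one of its end
  points, which belong to the Cantor set.\<close>

lemma connected_component_gap:
  assumes l: "l \<in> gap_starts n" and t: "t \<in> gap n l"
  shows "connected_component_set ({0..1} - cantor_set) t = gap n l"
proof (rule antisym)
  have sub: "gap n l \<subseteq> {0..1} - cantor_set"
    using gap_disjoint_cantor_set[OF l] gap_starts_range[OF l] by force
  then show "gap n l \<subseteq> connected_component_set ({0..1} - cantor_set) t"
    by (intro connected_component_maximal t) auto
  show "connected_component_set ({0..1} - cantor_set) t \<subseteq> gap n l"
  proof
    let ?C = "connected_component_set ({0..1} - cantor_set) t"
    fix s assume s: "s \<in> ?C"
    have tC: "t \<in> ?C" using t sub by (auto simp: connected_component_refl_eq)
    have iv: "is_interval ?C" by (simp add: is_interval_connected_1)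
    have "l \<notin> ?C" "l + 1 / 3 ^ n \<notin> ?C"
      using gap_ends_in_cantor_set[OF l] connected_component_subset by blast+
    then show "s \<in> gap n l"
      using mem_is_interval_1_I[OF iv s tC, of l] mem_is_interval_1_I[OF iv tC s, of "l + 1 / 3 ^ n"] t
      by force
  qed
qed

lemma Inf_gap: "Inf (gap n l) = (l::real)" and Sup_gap: "Sup (gap n l) = l + 1 / 3 ^ n"
  by (auto intro!: cInf_greaterThanLessThan cSup_greaterThanLessThan)

lemma gap_eq_iff: "gap n l = gap m (k::real) \<longleftrightarrow> n = m \<and> l = k"
proof
  assume eq: "gap n l = gap m k"
  then have "l = k" "l + 1 / 3 ^ n = k + 1 / 3 ^ m" using Inf_gap Sup_gap by metis+
  then have "(3::real) ^ n = 3 ^ m" by simp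
  then show "n = m \<and> l = k" using \<open>l = k\<close> by (simp add: power_inject_exp)
qed simp

lemma gap_level_gap: "gap_level (gap n l) = n"
  unfolding gap_level_def Inf_gap Sup_gap by (rule the_equality) (auto simp: power_inject_exp)

lemma cantor_gaps_eq: "cantor_gaps = (\<lambda>(n, l). gap n l) ` (SIGMA n:UNIV. gap_starts n)"
proof (intro equalityI subsetI)
  fix I assume "I \<in> cantor_gaps"
  then obtain t where t: "t \<in> {0..1} - cantor_set" "I = connected_component_set ({0..1} - cantor_set) t"
    by (auto simp: cantor_gaps_def components_def)
  then obtain n l where "l \<in> gap_starts n" "t \<in> gap n l" using gap_exists[OF t(1)] by metis
  then show "I \<in> (\<lambda>(n, l). gap n l) ` (SIGMA n:UNIV. gap_starts n)"
    using t connected_component_gap[of l n t] by (intro image_eqI[of _ _ "(n, l)"]) auto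
next
  fix I assume "I \<in> (\<lambda>(n, l). gap n l) ` (SIGMA n:UNIV. gap_starts n)"
  then obtain n l where l: "l \<in> gap_starts n" "I = gap n l" by auto
  define e :: real where "e = 1 / 3 ^ n"
  let ?t = "l + e / 2"
  have "e > 0" by (simp add: e_def)
  then have t: "?t \<in> gap n l" unfolding e_def[symmetric] by simp
  then have "?t \<in> {0..1} - cantor_set"
    using gap_disjoint_cantor_set[OF l(1) t] gap_starts_range[OF l(1)] by force
  then show "I \<in> cantor_gaps"
    using connected_component_gap[OF l(1) t] l(2) by (auto simp: cantor_gaps_def components_def)
qed

text \<open>The number of the circle around which \<open>ell_tau\<close> runs on the gap. The gaps of level \<open>n\<close> have numbers
  from \<open>2\<^bsup>n-1\<^esup>\<close> to \<open>2\<^bsup>n\<^esup> - 1\<close>; hence the numbering is injective, and only finitely many gaps have a number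
  below a given bound.\<close>

definition gap_index :: "nat \<Rightarrow> real \<Rightarrow> nat" where
  "gap_index n l = 2 ^ (n - 1) + card {k \<in> gap_starts n. k \<le> l} - 1"

lemma gap_rank_gap:
  "gap_rank (gap n l) = card {k \<in> gap_starts n. k \<le> l}"
proof -
  have "{J \<in> cantor_gaps. gap_level J = gap_level (gap n l) \<and> Inf J \<le> Inf (gap n l)}
      = (\<lambda>k. gap n k) ` {k \<in> gap_starts n. k \<le> l}"
    by (auto simp: cantor_gaps_eq gap_level_gap Inf_gap image_iff)
  moreover have "inj_on (\<lambda>k. gap n k) A" for A :: "real set"
    by (auto simp: inj_on_def gap_eq_iff)
  ultimately show ?thesis by (simp add: gap_rank_def card_image)
qed

lemma gap_rank_bounds:
  assumes "l \<in> gap_starts (Suc n)"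
  shows "1 \<le> card {k \<in> gap_starts (Suc n). k \<le> l}" "card {k \<in> gap_starts (Suc n). k \<le> l} \<le> 2 ^ n"
proof -
  have "{k \<in> gap_starts (Suc n). k \<le> l} \<noteq> {}" using assms by auto
  then show "1 \<le> card {k \<in> gap_starts (Suc n). k \<le> l}"
    using finite_gap_starts[of "Suc n"] by (simp add: Suc_le_eq card_gt_0_iff)
  show "card {k \<in> gap_starts (Suc n). k \<le> l} \<le> 2 ^ n"
    by (rule order_trans[OF card_mono card_gap_starts]) (auto simp: finite_gap_starts)
qed

lemma gap_index_bounds:
  assumes "l \<in> gap_starts n"
  shows "2 ^ (n - 1) \<le> gap_index n l" "gap_index n l < 2 ^ n"
proof -
  obtain m where "n = Suc m" using gap_starts_0_iff[OF assms] not0_implies_Suc by blast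
  then show "2 ^ (n - 1) \<le> gap_index n l" "gap_index n l < 2 ^ n"
    using gap_rank_bounds[of l m] assms by (auto simp: gap_index_def)
qed

lemma gap_index_pos: "l \<in> gap_starts n \<Longrightarrow> gap_index n l \<ge> 1"
  using gap_index_bounds(1)[of l n] one_le_power[of "2::nat" "n - 1"] by linarith

lemma gap_index_inj:
  assumes "l \<in> gap_starts n" "k \<in> gap_starts m" "gap_index n l = gap_index m k"
  shows "n = m \<and> l = k"
proof -
  have *: "n \<le> m" if "l \<in> gap_starts n" "k \<in> gap_starts m" "gap_index n l = gap_index m k" for n m l k
  proof (rule ccontr)
    assume "\<not> n \<le> m"
    then have "(2::nat) ^ m \<le> 2 ^ (n - 1)" by (intro power_increasing) auto
    then show False using gap_index_bounds(1)[OF that(1)] gap_index_bounds(2)[OF that(2)] that(3) by linarith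
  qed
  have nm: "n = m" using *[OF assms] *[OF assms(2,1) assms(3)[symmetric]] by simp
  obtain j where j: "n = Suc j" using gap_starts_0_iff[OF assms(1)] not0_implies_Suc by blast
  let ?S = "\<lambda>l. {k \<in> gap_starts n. k \<le> l}"
  have card: "card (?S l) = card (?S k)"
    using assms(3) nm gap_rank_bounds(1)[of l j] gap_rank_bounds(1)[of k j] assms(1,2) j
    by (auto simp: gap_index_def)
  have "l = k"
  proof (rule ccontr)
    assume "l \<noteq> k"
    then have "l \<in> ?S l - ?S k \<and> ?S k \<subseteq> ?S l \<or> k \<in> ?S k - ?S l \<and> ?S l \<subseteq> ?S k"
      using assms(1,2) nm by auto
    then have "?S k \<subset> ?S l \<or> ?S l \<subset> ?S k" by blast
    then show False using card finite_gap_starts[of n] psubset_card_mono[of "?S l" "?S k"]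
        psubset_card_mono[of "?S k" "?S l"] by auto
  qed
  with nm show ?thesis by simp
qed

text \<open>The formula holds on the closed gap, since at its ends both sides are the origin.\<close>

lemma ell_tau_gap:
  assumes l: "l \<in> gap_starts n" and t: "t \<in> {l..l + 1 / 3 ^ n}"
  shows "ell_tau t = ell (gap_index n l) ((t - l) * 3 ^ n)"
proof (cases "t \<in> gap n l")
  case True
  then have "t \<in> {0..1} - cantor_set"
    using gap_disjoint_cantor_set[OF l True] gap_starts_range[OF l] by force
  then show ?thesis
    by (simp add: ell_tau_def connected_component_gap[OF l True] Inf_gap Sup_gap gap_level_gap gap_rank_gap
        Let_def gap_index_def)
next
  case False
  then have "t = l \<or> t = l + 1 / 3 ^ n" using t by auto
  then have "t \<in> cantor_set" "(t - l) * 3 ^ n = 0 \<or> (t - l) * 3 ^ n = 1"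
    using gap_ends_in_cantor_set[OF l] by auto
  then show ?thesis by (auto simp: ell_tau_def)
qed

lemma ell_tau_cantor: "t \<in> cantor_set \<Longrightarrow> ell_tau t = (0, 0)"
  by (simp add: ell_tau_def)

section \<open>Loops that are trivial on the Cantor set\<close>

lemma null_family_ell:
  assumes "\<And>m. m \<ge> 1 \<Longrightarrow> m \<le> \<phi> m"
  shows "null_family (0, 0) (\<lambda>m. ell (\<phi> m))"
  unfolding null_family_def
proof (intro allI impI)
  fix U :: "(real \<times> real) set" assume "open U" "(0, 0) \<in> U"
  then obtain e where e: "e > 0" "ball (0, 0) e \<subseteq> U" by (auto simp: open_contains_ball)
  then obtain N where N: "N \<noteq> 0" "inverse (real N) < e / 2"
    using ex_inverse_of_nat_less[of "e / 2"] by auto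
  have "ell (\<phi> m) ` {0..1} \<subseteq> U" if "m \<ge> N" for m
  proof -
    have m: "\<phi> m \<ge> N" "\<phi> m \<ge> 1" using assms[of m] that N(1) by auto
    then have "2 / real (\<phi> m) \<le> 2 / real N" using N(1) by (intro divide_left_mono) auto
    also have "\<dots> < e" using N(2) by (simp add: inverse_eq_divide)
    finally have "cball (0, 0) (2 / real (\<phi> m)) \<subseteq> ball (0::real, 0::real) e" by auto
    then show ?thesis using earring_circle_subset_cball[OF m(2)] ell_image[OF m(2)] e(2) by blast
  qed
  then show "\<exists>N. \<forall>m\<ge>N. ell (\<phi> m) ` {0..1} \<subseteq> U" by blast
qed

lemma gap_closure_subset: "l \<in> gap_starts n \<Longrightarrow> {l..l + 1 / 3 ^ n} \<subseteq> {0..1}"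
  using gap_starts_range[of l n] by auto

lemma gap_coordinate: "s \<in> {0..1} \<Longrightarrow> l + s / 3 ^ n \<in> {l..l + 1 / 3 ^ n}" for l s :: real
  by (simp add: divide_right_mono)

lemma gap_coordinate_inverse:
  fixes l t :: real
  assumes "t \<in> {l..l + 1 / 3 ^ n}"
  shows "(t - l) * 3 ^ n \<in> {0..1}"
proof -
  have "(t - l) * 3 ^ n \<le> 1 / 3 ^ n * 3 ^ n" using assms by (intro mult_right_mono) auto
  then show ?thesis using assms by simp
qed

text \<open>Filling the gaps of the Cantor set with a null family of loops gives a continuous loop. Let \<open>F\<close> be
  closed. If \<open>y \<in> F\<close>, the points sent outside \<open>F\<close> form a union of open subsets of gaps; if \<open>y \<notin> F\<close>, only
  the finitely many gaps with small index contain points sent into \<open>F\<close>.\<close>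

lemma cantor_concatenation_loop:
  fixes h :: "real \<Rightarrow> 'a::topological_space"
  assumes null: "null_family y \<mu>" and loops: "\<And>m. m \<ge> 1 \<Longrightarrow> \<mu> m \<in> based_loops X y" and "y \<in> X"
    and h_cantor: "\<And>t. t \<in> cantor_set \<Longrightarrow> h t = y"
    and h_gap: "\<And>n l t. l \<in> gap_starts n \<Longrightarrow> t \<in> {l..l + 1 / 3 ^ n} \<Longrightarrow> h t = \<mu> (gap_index n l) ((t - l) * 3 ^ n)"
  shows "h \<in> based_loops X y"
proof -
  define G where "G n l t = \<mu> (gap_index n l) ((t - l) * 3 ^ n)" for n l t
  have gap_cont: "continuous_on {l..l + 1 / 3 ^ n} (G n l)" if l: "l \<in> gap_starts n" for n l
  proof -
    have \<mu>: "continuous_on {0..1} (\<mu> (gap_index n l))"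
      using loops[OF gap_index_pos[OF l]] by (simp add: based_loops_def path_def)
    have sub: "(\<lambda>t. (t - l) * 3 ^ n) ` {l..l + 1 / 3 ^ n} \<subseteq> {0..1}" using gap_coordinate_inverse by blast
    show ?thesis
      unfolding G_def by (rule continuous_on_compose2[OF \<mu> _ sub]) (intro continuous_intros)
  qed
  have in_closure: "gap n l \<subseteq> {l..l + 1 / 3 ^ n}" for n and l :: real by auto
  have "continuous_on {0..1} h"
    unfolding continuous_on_closed_vimage[OF closed_atLeastAtMost]
  proof (intro allI impI)
    fix F :: "'a set" assume F: "closed F"
    show "closed (h -` F \<inter> {0..1})"
    proof (cases "y \<in> F")
      case True
      define V where "V = (\<Union>(n, l)\<in>(SIGMA n:UNIV. gap_starts n). gap n l \<inter> G n l -` (- F))"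
      have "open (gap n l \<inter> G n l -` (- F))" if "l \<in> gap_starts n" for n l
        using F continuous_on_subset[OF gap_cont[OF that] in_closure]
        by (intro continuous_open_preimage) auto
      then have "open V" unfolding V_def by (intro open_UN) auto
      moreover have "h -` F \<inter> {0..1} = {0..1} - V"
      proof (intro equalityI subsetI)
        fix t assume t: "t \<in> h -` F \<inter> {0..1}"
        have "t \<notin> gap n l \<inter> G n l -` (- F)" if "l \<in> gap_starts n" for n l
          using t h_gap[OF that, of t] by (auto simp: G_def)
        then show "t \<in> {0..1} - V" using t by (auto simp: V_def)
      next
        fix t assume t: "t \<in> {0..1} - V"
        show "t \<in> h -` F \<inter> {0..1}"
        proof (cases "t \<in> cantor_set")
          case False
          then obtain n l where l: "l \<in> gap_starts n" "t \<in> gap n l" using t gap_exists[of t] by blast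
          then have "G n l t \<in> F" using t by (force simp: V_def)
          then show ?thesis using h_gap[OF l(1), of t] l(2) t by (simp add: G_def)
        qed (use t h_cantor True in simp)
      qed
      ultimately show ?thesis by (simp add: closed_Diff)
    next
      case False
      then obtain N where N: "\<And>m. m \<ge> N \<Longrightarrow> \<mu> m ` {0..1} \<subseteq> - F"
        using null F unfolding null_family_def by (metis ComplI open_Compl)
      have small: "n \<le> N" if l: "l \<in> gap_starts n" and t: "t \<in> {l..l + 1 / 3 ^ n}" "G n l t \<in> F" for n l t
      proof (rule ccontr)
        assume "\<not> n \<le> N"
        then have "N \<le> n - 1" by simp
        also have "\<dots> \<le> 2 ^ (n - 1)" by simp
        also have "\<dots> \<le> gap_index n l" using gap_index_bounds[OF l] by simp
        finally have "\<mu> (gap_index n l) ` {0..1} \<subseteq> - F" by (rule N)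
        moreover have "(t - l) * 3 ^ n \<in> {0..1}" using gap_coordinate_inverse[OF t(1)] .
        ultimately have "\<mu> (gap_index n l) ((t - l) * 3 ^ n) \<in> - F" by blast
        then show False using t(2) by (simp add: G_def)
      qed
      define V where "V = (\<Union>(n, l)\<in>(SIGMA n:{..N}. gap_starts n). {l..l + 1 / 3 ^ n} \<inter> G n l -` F)"
      have "closed ({l..l + 1 / 3 ^ n} \<inter> G n l -` F)" if "l \<in> gap_starts n" for n l
        using F gap_cont[OF that] by (intro continuous_closed_preimage) auto
      then have "closed V"
        unfolding V_def by (intro closed_UN finite_SigmaI) (auto simp: finite_gap_starts)
      moreover have "h -` F \<inter> {0..1} = V"
      proof (intro equalityI subsetI)
        fix t assume t: "t \<in> h -` F \<inter> {0..1}"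
        then have "t \<in> {0..1} - cantor_set" using h_cantor[of t] False by auto
        then obtain n l where l: "l \<in> gap_starts n" "t \<in> gap n l" using gap_exists by metis
        then have "G n l t \<in> F" using t h_gap[OF l(1), of t] by (simp add: G_def)
        moreover from l(2) have "t \<in> {l..l + 1 / 3 ^ n}" by simp
        ultimately show "t \<in> V"
          unfolding V_def using l(1) small[OF l(1), of t] by (intro UN_I[of "(n, l)"]) auto
      next
        fix t assume "t \<in> V"
        then obtain n l where "l \<in> gap_starts n" "t \<in> {l..l + 1 / 3 ^ n}" "G n l t \<in> F" by (auto simp: V_def)
        then show "t \<in> h -` F \<inter> {0..1}"
          using h_gap[of l n t] gap_closure_subset[of l n] by (auto simp: G_def)
      qed
      ultimately show ?thesis by simp
    qed
  qed
  moreover have "h t \<in> X" if t: "t \<in> {0..1}" for t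
  proof (cases "t \<in> cantor_set")
    case False
    then obtain n l where l: "l \<in> gap_starts n" "t \<in> gap n l" using t gap_exists[of t] by blast
    then have "(t - l) * 3 ^ n \<in> {0..1}" by (intro gap_coordinate_inverse) auto
    then have "\<mu> (gap_index n l) ((t - l) * 3 ^ n) \<in> X"
      using loops[OF gap_index_pos[OF l(1)]] by (auto simp: based_loops_def path_image_def)
    then show ?thesis using h_gap[OF l(1), of t] l(2) by simp
  qed (simp add: h_cantor \<open>y \<in> X\<close>)
  ultimately show ?thesis
    using h_cantor zero_one_in_cantor_set
    by (auto simp: based_loops_def path_def path_image_def pathstart_def pathfinish_def)
qed

lemma ell_tau_loop: "ell_tau \<in> based_loops earring (0, 0)"
  using null_family_ell[of "\<lambda>m. m"]
  by (rule cantor_concatenation_loop) (auto simp: ell_loop origin_in_earring ell_tau_cantor ell_tau_gap)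

lemma earring_map_ell:
  assumes "n \<ge> 1" "t \<in> {0..1}"
  shows "earring_map \<phi> (ell n t) = ell (\<phi> n) t"
  unfolding earring_map_def
proof (rule the_equality)
  fix w assume "\<exists>m\<ge>1. \<exists>s\<in>{0..1}. ell n t = ell m s \<and> w = ell (\<phi> m) s"
  then obtain m s where m: "m \<ge> 1" "s \<in> {0..1}" "ell n t = ell m s" "w = ell (\<phi> m) s" by blast
  then show "w = ell (\<phi> n) t" using ell_eq_cases[of n t m s] assms by auto
qed (use assms in blast)

lemma earring_map_origin: "earring_map \<phi> (0, 0) = (0, 0)"
  using earring_map_ell[of 1 0 \<phi>] by simp

lemma earring_map_ell_tau_gap:
  assumes "l \<in> gap_starts n" "t \<in> {l..l + 1 / 3 ^ n}"
  shows "earring_map \<phi> (ell_tau t) = ell (\<phi> (gap_index n l)) ((t - l) * 3 ^ n)"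
  unfolding ell_tau_gap[OF assms]
  using assms by (intro earring_map_ell gap_index_pos gap_coordinate_inverse)

lemma earring_map_ell_tau_loop:
  assumes "\<And>m. m \<ge> 1 \<Longrightarrow> m \<le> \<phi> m"
  shows "earring_map \<phi> \<circ> ell_tau \<in> based_loops earring (0, 0)"
  using null_family_ell[of \<phi>, OF assms]
proof (rule cantor_concatenation_loop)
  show "ell (\<phi> m) \<in> based_loops earring (0, 0)" if "m \<ge> 1" for m
    using assms[OF that] that by (intro ell_loop) simp
qed (auto simp: origin_in_earring ell_tau_cantor earring_map_origin earring_map_ell_tau_gap)

lemma based_loops_mono: "X \<subseteq> Y \<Longrightarrow> based_loops X x \<subseteq> based_loops Y x"
  by (auto simp: based_loops_def)

lemma f_odd_ell_tau_loop: "f_odd \<circ> ell_tau \<in> based_loops earring_plus (0, 0)"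
  and f_even_ell_tau_loop: "f_even \<circ> ell_tau \<in> based_loops earring_plus (0, 0)"
  unfolding f_odd_def f_even_def
  using based_loops_mono[OF earring_subset_plus] earring_map_ell_tau_loop by (simp_all add: subset_iff)

definition on_gap :: "nat \<Rightarrow> real \<Rightarrow> (real \<Rightarrow> 'a) \<Rightarrow> real \<Rightarrow> 'a" where
  "on_gap n l \<alpha> s = \<alpha> (l + s / 3 ^ n)"

text \<open>The loops obtained by cutting \<open>\<alpha>\<close> at the Cantor set, listed by gap index; numbers that are not the
  index of a gap get the constant loop.\<close>

definition gap_loop :: "'a \<Rightarrow> (real \<Rightarrow> 'a) \<Rightarrow> nat \<Rightarrow> real \<Rightarrow> 'a" where
  "gap_loop y \<alpha> m = (if \<exists>n l. l \<in> gap_starts n \<and> gap_index n l = m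
     then let (n, l) = SOME (n, l). l \<in> gap_starts n \<and> gap_index n l = m in on_gap n l \<alpha>
     else (\<lambda>_. y))"

lemma gap_loop_index:
  assumes "l \<in> gap_starts n"
  shows "gap_loop y \<alpha> (gap_index n l) = on_gap n l \<alpha>"
proof -
  let ?P = "\<lambda>(n', l'). l' \<in> gap_starts n' \<and> gap_index n' l' = gap_index n l"
  have "?P (SOME x. ?P x)" by (rule someI[of ?P "(n, l)"]) (use assms in simp)
  then have "(SOME x. ?P x) = (n, l)" using gap_index_inj assms by (auto split: prod.splits)
  then show ?thesis using assms by (auto simp: gap_loop_def)
qed

lemma gap_loop_cases:
  obtains (gap) n l where "l \<in> gap_starts n" "m = gap_index n l" "\<And>\<alpha>. gap_loop y \<alpha> m = on_gap n l \<alpha>"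
    | (const) "\<And>\<alpha>. gap_loop y \<alpha> m = (\<lambda>_. y)"
  using gap_loop_index by (metis gap_loop_def)

lemma on_gap_loop:
  assumes l: "l \<in> gap_starts n" and \<alpha>: "path \<alpha>" "path_image \<alpha> \<subseteq> X" "\<And>t. t \<in> cantor_set \<Longrightarrow> \<alpha> t = y"
  shows "on_gap n l \<alpha> \<in> based_loops X y"
proof -
  have sub: "(\<lambda>s. l + s / 3 ^ n) ` {0..1} \<subseteq> {0..1}"
    using gap_coordinate gap_closure_subset[OF l] by blast
  have "continuous_on {0..1} (on_gap n l \<alpha>)"
    unfolding on_gap_def
    by (rule continuous_on_compose2[OF \<alpha>(1)[unfolded path_def] _ sub]) (intro continuous_intros, simp)
  moreover have "on_gap n l \<alpha> ` {0..1} \<subseteq> X"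
    using \<alpha>(2) sub by (auto simp: path_image_def on_gap_def)
  ultimately show ?thesis
    using \<alpha>(3) gap_ends_in_cantor_set[OF l]
    by (simp add: based_loops_def path_def path_image_def pathstart_def pathfinish_def on_gap_def)
qed

lemma gap_loop_loop:
  assumes "path \<alpha>" "path_image \<alpha> \<subseteq> X" "\<And>t. t \<in> cantor_set \<Longrightarrow> \<alpha> t = y" "y \<in> X"
  shows "gap_loop y \<alpha> m \<in> based_loops X y"
  using assms by (cases rule: gap_loop_cases[of m y]) (auto simp: on_gap_loop based_loops_const)

text \<open>By compactness, every neighbourhood of the Cantor set contains all points within some distance \<open>e\<close>
  of it, hence all gaps shorter than \<open>e\<close>.\<close>

lemma null_family_gap_loop:
  assumes \<alpha>: "path \<alpha>" "\<And>t. t \<in> cantor_set \<Longrightarrow> \<alpha> t = y"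
  shows "null_family y (gap_loop y \<alpha>)"
  unfolding null_family_def
proof (intro allI impI)
  fix U :: "'a set" assume U: "open U" "y \<in> U"
  from \<alpha>(1) U(1) obtain V where V: "open V" "V \<inter> {0..1} = \<alpha> -` U \<inter> {0..1}"
    by (auto simp: path_def continuous_on_open_invariant)
  have "compact cantor_set"
    using closed_cantor_set cantor_set_subset bounded_subset[of "{0..1}" cantor_set]
    by (auto simp: compact_eq_bounded_closed)
  moreover have "cantor_set \<subseteq> V" using V(2) \<alpha>(2) U(2) cantor_set_subset by blast
  ultimately obtain e where e: "e > 0" "(\<Union>x\<in>cantor_set. ball x e) \<subseteq> V"
    using compact_subset_open_imp_ball_epsilon_subset V(1) by metis
  obtain M where M: "(1 / 3) ^ M < e" using real_arch_pow_inv[of e "1/3"] e(1) by auto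
  have "gap_loop y \<alpha> m ` {0..1} \<subseteq> U" if m: "m \<ge> 2 ^ M" for m
  proof (cases rule: gap_loop_cases[of m y])
    case (gap n l)
    have "(2::nat) ^ M < 2 ^ n" using m gap gap_index_bounds[of l n] by linarith
    then have "M < n" by (simp add: power_strict_increasing_iff)
    then have "(1 / 3 :: real) ^ n \<le> (1 / 3) ^ M" by (intro power_decreasing) auto
    then have small: "1 / 3 ^ n < e" using M by (simp add: power_one_over)
    show ?thesis
    proof
      fix z assume "z \<in> gap_loop y \<alpha> m ` {0..1}"
      then obtain s where s: "s \<in> {l..l + 1 / 3 ^ n}" "z = \<alpha> s"
        unfolding gap(3) on_gap_def using gap_coordinate by blast
      then have "s \<in> ball l e" using small by (simp add: dist_real_def)
      then have "s \<in> V" using e(2) gap_ends_in_cantor_set[OF gap(1)] by blast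
      then show "z \<in> U" using V(2) s gap_closure_subset[OF gap(1)] by auto
    qed
  qed (use U in auto)
  then show "\<exists>N. \<forall>m\<ge>N. gap_loop y \<alpha> m ` {0..1} \<subseteq> U" by blast
qed

text \<open>The order of the circles in which \<open>f_odd\<close> sees the first family and \<open>f_even\<close> the second.\<close>

definition interleave :: "(nat \<Rightarrow> 'a) \<Rightarrow> (nat \<Rightarrow> 'a) \<Rightarrow> nat \<Rightarrow> 'a" where
  "interleave a b k = (if odd k then a ((k + 1) div 2) else b (k div 2))"

lemma interleave_odd: "m \<ge> 1 \<Longrightarrow> interleave a b (2 * m - Suc 0) = a m"
  and interleave_even: "interleave a b (2 * m) = b m"
  by (auto simp: interleave_def)

lemma null_family_interleave:
  assumes "null_family y a" "null_family y b"
  shows "null_family y (interleave a b)"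
  unfolding null_family_def
proof (intro allI impI)
  fix U :: "'a set" assume U: "open U" "y \<in> U"
  obtain N M where "\<And>n. n \<ge> N \<Longrightarrow> a n ` {0..1} \<subseteq> U" "\<And>n. n \<ge> M \<Longrightarrow> b n ` {0..1} \<subseteq> U"
    using assms U unfolding null_family_def by metis
  moreover have "(k + 1) div 2 \<ge> N \<and> k div 2 \<ge> M" if "k \<ge> 2 * (N + M)" for k
    using that by auto
  ultimately show "\<exists>N. \<forall>k\<ge>N. interleave a b k ` {0..1} \<subseteq> U"
    by (intro exI[of _ "2 * (N + M)"]) (simp add: interleave_def)
qed

text \<open>The image of a generated subgroup is generated by the images of the generators.\<close>

lemma induced_hom_P_subgroup:
  assumes f: "based_map earring_plus earring_plus_base X x f" and x: "x \<in> X"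
    and H: "subgroup H (fundamental_group X x)"
    and gens: "\<And>n. n \<ge> 1 \<Longrightarrow> induced_hom X f (p_elt n) \<in> H"
  shows "induced_hom X f ` P_subgroup \<subseteq> H"
proof -
  interpret w: tail earring_plus earring_plus_base "(0, 0)" whisker by (rule tail_whisker)
  interpret G: group "fundamental_group X x" by (rule group_fundamental_group[OF x])
  interpret group_hom "fundamental_group earring_plus earring_plus_base" "fundamental_group X x" "induced_hom X f"
    by unfold_locales (rule induced_hom_hom[OF f])
  have "ell n \<in> based_loops earring_plus (0, 0)" if "n \<ge> 1" for n
    using ell_loop[OF that] based_loops_mono[OF earring_subset_plus] by blast
  then have "p_elt ` {1..} \<subseteq> carrier (fundamental_group earring_plus earring_plus_base)"
    by (auto simp: p_elt_def whisker_class_lasso intro!: w.lasso_carrier based_loops_join based_loops_reversepath)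
  then have "induced_hom X f ` P_subgroup = generate (fundamental_group X x) (induced_hom X f ` p_elt ` {1..})"
    unfolding P_subgroup_def by (rule generate_img[symmetric])
  also have "\<dots> \<subseteq> H" using gens by (intro G.generate_subgroup_incl H) auto
  finally show ?thesis .
qed

text \<open>The meaning of closedness: if two loops return to the base point on the Cantor set and differ by an
  element of \<open>H\<close> on every single gap, then they differ by an element of \<open>H\<close> as a whole. To see this, put
  the pieces of \<open>\<alpha>\<close> on the odd circles and the pieces of \<open>\<beta>\<close> on the even ones. The resulting map \<open>f\<close>
  sends the generators of \<open>P_subgroup\<close> to the differences on the gaps, and \<open>p_tau\<close> to the difference of
  \<open>\<alpha>\<close> and \<open>\<beta>\<close>.\<close>

lemma closed_subgroup_gapwise:
  assumes closed: "closed_subgroup earring_plus earring_plus_base P_subgroup p_tau X x H"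
    and H: "subgroup H (fundamental_group X x)" and "tail X x y \<omega>"
    and \<alpha>: "\<alpha> \<in> based_loops X y" "\<And>t. t \<in> cantor_set \<Longrightarrow> \<alpha> t = y"
    and \<beta>: "\<beta> \<in> based_loops X y" "\<And>t. t \<in> cantor_set \<Longrightarrow> \<beta> t = y"
    and gaps: "\<And>n l. l \<in> gap_starts n \<Longrightarrow>
      lasso X \<omega> (on_gap n l \<alpha> +++ reversepath (on_gap n l \<beta>)) \<in> H"
  shows "lasso X \<omega> (\<alpha> +++ reversepath \<beta>) \<in> H"
proof -
  interpret tail X x y \<omega> by fact
  note A = based_loopsD(1,2)[OF \<alpha>(1)] \<alpha>(2) and B = based_loopsD(1,2)[OF \<beta>(1)] \<beta>(2)
  define \<mu> where "\<mu> = interleave (gap_loop y \<alpha>) (gap_loop y \<beta>)"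
  have loops: "gap_loop y \<alpha> m \<in> based_loops X y" "gap_loop y \<beta> m \<in> based_loops X y" for m
    using gap_loop_loop[OF A finish_in] gap_loop_loop[OF B finish_in] by blast+
  have "\<mu> k \<in> based_loops X y" for k
    using loops by (simp add: \<mu>_def interleave_def)
  moreover have "null_family y \<mu>"
    unfolding \<mu>_def using A(1,3) B(1,3) by (intro null_family_interleave null_family_gap_loop)
  ultimately obtain f where f: "based_map earring_plus earring_plus_base X x f"
    and f_whisker: "\<And>t. t \<in> {0..1} \<Longrightarrow> f (whisker t) = \<omega> t"
    and f_ell: "\<And>n t. n \<ge> 1 \<Longrightarrow> t \<in> {0..1} \<Longrightarrow> f (ell n t) = \<mu> n t"
    using glue_on_earring_plus[OF \<open>tail X x y \<omega>\<close>] by metis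
  have induced: "induced_hom X f (whisker_class p) = lasso X \<omega> q"
    if "p \<in> based_loops earring_plus (0, 0)" "\<And>t. t \<in> {0..1} \<Longrightarrow> f (p t) = q t" for p q
    unfolding whisker_class_lasso induced_hom_lasso[OF tail_whisker f that(1)]
    using that(2) f_whisker by (intro lasso_cong_on) auto
  have ell_plus: "ell n \<in> based_loops earring_plus (0, 0)" if "n \<ge> 1" for n
    using ell_loop[OF that] based_loops_mono[OF earring_subset_plus] by blast
  have "induced_hom X f (p_elt m) \<in> H" if m: "m \<ge> 1" for m
  proof -
    have "induced_hom X f (p_elt m) = lasso X \<omega> (gap_loop y \<alpha> m +++ reversepath (gap_loop y \<beta> m))"
      unfolding p_elt_def
    proof (rule induced)
      show "ell (2 * m - 1) +++ reversepath (ell (2 * m)) \<in> based_loops earring_plus (0, 0)"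
        using m by (intro based_loops_join based_loops_reversepath ell_plus) auto
      show "f ((ell (2 * m - 1) +++ reversepath (ell (2 * m))) t)
          = (gap_loop y \<alpha> m +++ reversepath (gap_loop y \<beta> m)) t" if "t \<in> {0..1}" for t
        using that m f_ell[of "2 * m - 1"] f_ell[of "2 * m"]
        by (auto simp: joinpaths_def reversepath_def \<mu>_def interleave_odd interleave_even)
    qed
    also have "\<dots> \<in> H"
    proof (cases rule: gap_loop_cases[of m y])
      case (gap n l)
      then show ?thesis using gaps[of l n] by simp
    next
      case const
      then have "gap_loop y \<alpha> m +++ reversepath (gap_loop y \<beta> m) = (\<lambda>_. y)"
        by (auto simp: joinpaths_def reversepath_def)
      then show ?thesis using subgroup.one_closed[OF H] by (simp add: lasso_const)
    qed
    finally show ?thesis .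
  qed
  then have "induced_hom X f p_tau \<in> H"
    using closed f induced_hom_P_subgroup[OF f start_in H] by (auto simp: closed_subgroup_def)
  moreover have "induced_hom X f p_tau = lasso X \<omega> (\<alpha> +++ reversepath \<beta>)"
    unfolding p_tau_def
  proof (rule induced)
    show "(f_odd \<circ> ell_tau) +++ reversepath (f_even \<circ> ell_tau) \<in> based_loops earring_plus (0, 0)"
      by (intro based_loops_join based_loops_reversepath f_odd_ell_tau_loop f_even_ell_tau_loop)
    have "f (f_odd (ell_tau t)) = \<alpha> t \<and> f (f_even (ell_tau t)) = \<beta> t" if t: "t \<in> {0..1}" for t
    proof (cases "t \<in> cantor_set")
      case True
      have "f (0, 0) = y" using f_whisker[of 1] tail_finish by (simp add: whisker_def pathfinish_def)
      then show ?thesis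
        using True \<alpha>(2) \<beta>(2) by (simp add: ell_tau_cantor f_odd_def f_even_def earring_map_origin)
    next
      case False
      then obtain n l where l: "l \<in> gap_starts n" "t \<in> gap n l" using t gap_exists[of t] by blast
      define m where "m = gap_index n l"
      define s where "s = (t - l) * 3 ^ n"
      have m: "m \<ge> 1" unfolding m_def using l(1) by (rule gap_index_pos)
      have s: "s \<in> {0..1}" "on_gap n l \<gamma> s = \<gamma> t" for \<gamma> :: "real \<Rightarrow> 'a"
        using l(2) gap_coordinate_inverse[of t l n] by (auto simp: s_def on_gap_def)
      have "f_odd (ell_tau t) = ell (2 * m - 1) s" "f_even (ell_tau t) = ell (2 * m) s"
        using l by (simp_all add: f_odd_def f_even_def earring_map_ell_tau_gap m_def s_def)
      then have "f (f_odd (ell_tau t)) = gap_loop y \<alpha> m s" "f (f_even (ell_tau t)) = gap_loop y \<beta> m s"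
        using f_ell[of "2 * m - 1" s] f_ell[of "2 * m" s] m s(1)
        by (simp_all add: \<mu>_def interleave_odd interleave_even)
      then show ?thesis using s(2) by (simp add: m_def gap_loop_index[OF l(1)])
    qed
    then show "f (((f_odd \<circ> ell_tau) +++ reversepath (f_even \<circ> ell_tau)) t) = (\<alpha> +++ reversepath \<beta>) t"
      if "t \<in> {0..1}" for t
      using that by (auto simp: joinpaths_def reversepath_def)
  qed
  ultimately show ?thesis by simp
qed

section \<open>Closed subgroups are normal\<close>

lemma tail_const: "x \<in> X \<Longrightarrow> tail X x x (\<lambda>_. x)"
  by unfold_locales (auto simp: path_const)

lemma lasso_const_tail:
  assumes "p \<in> based_loops X x"
  shows "lasso X (\<lambda>_. x) p = path_class X p"
proof -
  note p = based_loopsD[OF assms]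
  have x: "x \<in> X" using p by (auto simp: path_image_def pathstart_def)
  have "reversepath (\<lambda>_. x) = (\<lambda>_. x)" by (simp add: reversepath_def fun_eq_iff)
  then have "lasso X (\<lambda>_. x) p = path_class X ((\<lambda>_. x) +++ p +++ (\<lambda>_. x))" by (simp add: lasso_def)
  also have "\<dots> = path_class X (p +++ (\<lambda>_. x))"
    using p x by (intro path_class_eq homotopic_paths_const_join) (auto simp: path_const subset_path_image_join)
  also have "\<dots> = path_class X p"
    using p by (intro path_class_eq homotopic_paths_join_const)
  finally show ?thesis .
qed

lemma lasso_join_reversepath_self:
  assumes "tail X x y \<omega>" "p \<in> based_loops X y" "\<And>t. t \<in> {0..1} \<Longrightarrow> p t = q t"
  shows "lasso X \<omega> (p +++ reversepath q) = \<one>\<^bsub>fundamental_group X x\<^esub>"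
proof -
  interpret tail X x y \<omega> by fact
  have "lasso X \<omega> (p +++ reversepath q) = lasso X \<omega> (p +++ reversepath p)"
    using assms(3) by (intro lasso_cong_on) (auto simp: joinpaths_def reversepath_def)
  then show ?thesis using assms(2) lasso_carrier by (simp add: lasso_join_reversepath)
qed

text \<open>A reparametrization of \<open>[0,1]\<close> that maps the gap \<open>(1/3, 2/3)\<close> onto the first half and the gap
  \<open>(7/9, 8/9)\<close> onto the second half, and is constant elsewhere.\<close>

definition collapse :: "real \<Rightarrow> real" where
  "collapse t = max 0 (min 1 (3 * t - 1)) / 2 + max 0 (min 1 (9 * t - 7)) / 2"

lemma collapse_range: "collapse t \<in> {0..1}"
  by (auto simp: collapse_def min_def max_def field_simps)

text \<open>Put a loop \<open>\<xi>\<close> on the gap \<open>(1/3, 2/3)\<close> and a loop \<open>\<eta>\<close> with class in \<open>H\<close> on the gap \<open>(7/9, 8/9)\<close>, and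
  compare with the loop that has \<open>\<xi>\<close> on the first gap only. On every gap the two differ by \<open>1\<close> or by the
  class of \<open>\<eta>\<close>, so as a whole they differ by an element of \<open>H\<close>; this element is the conjugate of the
  class of \<open>\<eta>\<close> by the class of \<open>\<xi>\<close>.\<close>

lemma closed_subgroup_normal:
  assumes closed: "closed_subgroup earring_plus earring_plus_base P_subgroup p_tau X x H"
    and H: "subgroup H (fundamental_group X x)" and x: "x \<in> X"
  shows "H \<lhd> fundamental_group X x"
proof -
  interpret tail X x x "\<lambda>_. x" using x by (rule tail_const)
  have gap79: "7 / 9 \<in> gap_starts 2" by (simp add: numeral_2_eq_2)
  have C79: "7 / 9 \<in> cantor_set" "8 / 9 \<in> cantor_set"
    using gap_ends_in_cantor_set[OF gap79] by simp_all
  have nC79: "t \<notin> cantor_set" if "7 / 9 < t" "t < 8 / 9" for t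
    using gap_disjoint_cantor_set[OF gap79, of t] that by simp
  have "path_class X \<xi> \<otimes>\<^bsub>fundamental_group X x\<^esub> path_class X \<eta>
      \<otimes>\<^bsub>fundamental_group X x\<^esub> inv\<^bsub>fundamental_group X x\<^esub> path_class X \<xi> \<in> H"
    if \<xi>: "\<xi> \<in> based_loops X x" and \<eta>: "\<eta> \<in> based_loops X x" "path_class X \<eta> \<in> H" for \<xi> \<eta>
  proof -
    define \<alpha> where "\<alpha> = (\<xi> +++ \<eta>) \<circ> collapse"
    define \<beta> where "\<beta> = (\<xi> +++ (\<lambda>_. x)) \<circ> collapse"
    have hom: "homotopic_paths X (\<xi> +++ \<zeta>) ((\<xi> +++ \<zeta>) \<circ> collapse)" if "\<zeta> \<in> based_loops X x" for \<zeta>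
      using based_loops_join[OF \<xi> that]
      by (intro homotopic_paths_reparametrize[where f = collapse])
         (use collapse_range in \<open>auto simp: based_loops_def\<close>, auto simp: collapse_def intro!: continuous_intros)
    have const: "(\<lambda>_. x) \<in> based_loops X x" using x by (rule based_loops_const)
    have on_cantor: "((\<xi> +++ \<zeta>) \<circ> collapse) t = x" if "\<zeta> \<in> based_loops X x" "t \<in> cantor_set" for \<zeta> t
    proof -
      have "t \<le> 1 / 3 \<or> 2 / 3 \<le> t \<and> t \<le> 7 / 9 \<or> 8 / 9 \<le> t"
        using cantor_set_middle[of t] nC79[of t] that(2) by force
      then obtain c where c: "collapse t = c" "c \<in> {0, 1 / 2, 1}" by (auto simp: collapse_def)
      have "\<xi> 0 = x" "\<xi> 1 = x" "\<zeta> 0 = x" "\<zeta> 1 = x"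
        using based_loopsD(3,4)[OF \<xi>] based_loopsD(3,4)[OF that(1)] by (auto simp: pathstart_def pathfinish_def)
      then have "(\<xi> +++ \<zeta>) 0 = x" "(\<xi> +++ \<zeta>) (1 / 2) = x" "(\<xi> +++ \<zeta>) 1 = x" by (simp_all add: joinpaths_def)
      then show ?thesis using c by (metis comp_apply insertE singletonD)
    qed
    have \<alpha>: "\<alpha> \<in> based_loops X x" "\<And>t. t \<in> cantor_set \<Longrightarrow> \<alpha> t = x"
      and \<beta>: "\<beta> \<in> based_loops X x" "\<And>t. t \<in> cantor_set \<Longrightarrow> \<beta> t = x"
      using hom on_cantor \<eta>(1) const \<xi> based_loops_join based_loops_homotopic
      by (metis \<alpha>_def, metis \<alpha>_def, metis \<beta>_def, metis \<beta>_def)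
    have "lasso X (\<lambda>_. x) (\<alpha> +++ reversepath \<beta>) \<in> H"
      using closed H tail_axioms \<alpha> \<beta>
    proof (rule closed_subgroup_gapwise)
      fix n l assume l: "l \<in> gap_starts n"
      let ?r = "l + 1 / 3 ^ n"
      have loops: "on_gap n l \<alpha> \<in> based_loops X x" "on_gap n l \<beta> \<in> based_loops X x"
        using \<alpha> \<beta> based_loopsD by (metis on_gap_loop[OF l])+
      show "lasso X (\<lambda>_. x) (on_gap n l \<alpha> +++ reversepath (on_gap n l \<beta>)) \<in> H"
      proof (cases "l = 7 / 9 \<and> ?r = 8 / 9")
        case True
        then have e: "l = 7 / 9" "1 / 3 ^ n = (1 / 9 :: real)" by auto
        have "on_gap n l \<alpha> s = \<eta> s \<and> on_gap n l \<beta> s = x" if s: "s \<in> {0..1}" for s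
        proof -
          have "l + s / 3 ^ n = 7 / 9 + s / 9"
            using e by (metis times_divide_eq_right mult.right_neutral)
          moreover have "collapse (7 / 9 + s / 9) = 1 / 2 + s / 2" using s by (simp add: collapse_def)
          ultimately show ?thesis using s based_loopsD(3,4)[OF \<xi>] based_loopsD(3,4)[OF \<eta>(1)]
            by (auto simp: on_gap_def \<alpha>_def \<beta>_def joinpaths_def pathstart_def pathfinish_def)
        qed
        then have "lasso X (\<lambda>_. x) (on_gap n l \<alpha> +++ reversepath (on_gap n l \<beta>)) = lasso X (\<lambda>_. x) (\<eta> +++ (\<lambda>_. x))"
          by (intro lasso_cong_on) (auto simp: joinpaths_def reversepath_def)
        also have "\<dots> = lasso X (\<lambda>_. x) \<eta> \<otimes>\<^bsub>fundamental_group X x\<^esub> \<one>\<^bsub>fundamental_group X x\<^esub>"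
          using \<eta>(1) const by (simp add: lasso_join lasso_const)
        also have "\<dots> = path_class X \<eta>"
          using \<eta>(1) lasso_carrier lasso_const_tail by fastforce
        finally show ?thesis using \<eta>(2) by simp
      next
        case False
        have C: "l \<in> cantor_set" "?r \<in> cantor_set" using gap_ends_in_cantor_set[OF l] by auto
        have "7 / 9 \<notin> gap n l" "8 / 9 \<notin> gap n l"
          using C79 gap_disjoint_cantor_set[OF l] by blast+
        moreover have "l < ?r" by simp
        ultimately have "?r \<le> 7 / 9 \<or> 8 / 9 \<le> l"
          using False nC79[of l] nC79[of ?r] C unfolding greaterThanLessThan_iff by linarith
        moreover have "\<alpha> t = \<beta> t" if "t \<le> 7 / 9 \<or> 8 / 9 \<le> t" for t
          using that based_loopsD(3,4)[OF \<eta>(1)]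
          by (auto simp: \<alpha>_def \<beta>_def collapse_def joinpaths_def pathstart_def pathfinish_def)
        ultimately have "on_gap n l \<alpha> s = on_gap n l \<beta> s" if "s \<in> {0..1}" for s
          using gap_coordinate[OF that, of l n] unfolding on_gap_def by (metis atLeastAtMost_iff order_trans)
        then show ?thesis
          using lasso_join_reversepath_self[OF tail_axioms loops(1)] subgroup.one_closed[OF H] by simp
      qed
    qed
    moreover have "lasso X (\<lambda>_. x) \<alpha> = path_class X \<xi> \<otimes>\<^bsub>fundamental_group X x\<^esub> path_class X \<eta>"
      using hom[OF \<eta>(1)] \<xi> \<eta>(1) lasso_cong[OF homotopic_paths_sym[OF hom[OF \<eta>(1)]]] \<alpha>(1)
      by (simp add: \<alpha>_def lasso_join lasso_const_tail)
    moreover have "lasso X (\<lambda>_. x) \<beta> = path_class X \<xi>"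
      using lasso_cong[OF homotopic_paths_sym[OF hom[OF const]]] \<beta>(1) \<xi> const lasso_carrier[OF \<xi>]
      by (simp add: \<beta>_def lasso_join lasso_const lasso_const_tail)
    ultimately show ?thesis using \<alpha>(1) \<beta>(1) by (simp add: lasso_join_reversepath)
  qed
  note conjugate = this
  show ?thesis
  proof (intro G.normal_invI H)
    fix g h assume g: "g \<in> carrier (fundamental_group X x)" and h: "h \<in> H"
    then have "h \<in> carrier (fundamental_group X x)" using subgroup.mem_carrier[OF H] by blast
    with g h conjugate show "g \<otimes>\<^bsub>fundamental_group X x\<^esub> h \<otimes>\<^bsub>fundamental_group X x\<^esub> inv\<^bsub>fundamental_group X x\<^esub> g \<in> H"
      unfolding carrier_fundamental_group by blast
  qed
qed

section \<open>Transfinite products give closure\<close>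

lemma null_family_compose:
  assumes "null_family y \<mu>" "continuous_on T f" "\<And>n. \<mu> n ` {0..1} \<subseteq> T" "y \<in> T"
  shows "null_family (f y) (\<lambda>n. f \<circ> \<mu> n)"
  unfolding null_family_def
proof (intro allI impI)
  fix U :: "'b set" assume U: "open U" "f y \<in> U"
  obtain V where V: "open V" "V \<inter> T = f -` U \<inter> T"
    using assms(2) U(1) unfolding continuous_on_open_invariant by blast
  then obtain N where "\<And>n. n \<ge> N \<Longrightarrow> \<mu> n ` {0..1} \<subseteq> V"
    using assms(1,4) U(2) unfolding null_family_def by blast
  then show "\<exists>N. \<forall>n\<ge>N. (f \<circ> \<mu> n) ` {0..1} \<subseteq> U" using assms(3) V(2) by (intro exI[of _ N]) fastforce
qed

text \<open>The map \<open>f \<circ> earring_map \<phi>\<close>, with the whisker left in place. The growth condition on \<open>\<phi>\<close> makes the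
  rearranged loops a null family again.\<close>

lemma precompose_circle_map:
  assumes f: "based_map earring_plus earring_plus_base X x f" and \<phi>: "\<And>m. m \<ge> 1 \<Longrightarrow> m \<le> \<phi> m"
  obtains a where "based_map earring_plus earring_plus_base X x a"
    "\<And>t. t \<in> {0..1} \<Longrightarrow> a (whisker t) = f (whisker t)"
    "\<And>n t. n \<ge> 1 \<Longrightarrow> t \<in> {0..1} \<Longrightarrow> a (ell n t) = f (ell (\<phi> n) t)"
    "\<And>t. t \<in> {0..1} \<Longrightarrow> a (ell_tau t) = f (earring_map \<phi> (ell_tau t))"
proof -
  have in_plus: "ell k t \<in> earring_plus" for k t
    using ell_in_earring[of k t] origin_in_earring earring_subset_plus
    by (cases "k = 0") (auto simp: ell_def)
  have ell_plus: "ell (\<phi> n) \<in> based_loops earring_plus (0, 0)" if "n \<ge> 1" for n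
    using ell_loop[of "\<phi> n"] \<phi>[OF that] that based_loops_mono[OF earring_subset_plus] by auto
  have cont: "continuous_on earring_plus f" and "f \<in> earring_plus \<rightarrow> X" using f by (auto simp: based_map_def)
  have "null_family (f (0, 0)) (\<lambda>n. f \<circ> ell (\<phi> n))"
    using null_family_ell[of \<phi>, OF \<phi>] cont in_plus in_plus[of 1 0]
    by (intro null_family_compose[where T = earring_plus]) auto
  moreover have "f \<circ> ell (\<phi> n) \<in> based_loops X (f (0, 0))" if "n \<ge> 1" for n
    using ell_plus[OF that] f by (intro based_loops_image) (auto simp: based_map_def)
  ultimately obtain a where a: "based_map earring_plus earring_plus_base X x a"
    "\<And>t. t \<in> {0..1} \<Longrightarrow> a (whisker t) = f (whisker t)"
    "\<And>n t. n \<ge> 1 \<Longrightarrow> t \<in> {0..1} \<Longrightarrow> a (ell n t) = f (ell (\<phi> n) t)"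
    using glue_on_earring_plus[OF tail_image_map[OF tail_whisker f], of "\<lambda>n. f \<circ> ell (\<phi> n)"] by auto
  have "a (ell_tau t) = f (earring_map \<phi> (ell_tau t))" if t: "t \<in> {0..1}" for t
  proof (cases "t \<in> cantor_set")
    case True
    then show ?thesis using a(2)[of 1] by (simp add: ell_tau_cantor earring_map_origin whisker_def)
  next
    case False
    then obtain n l where l: "l \<in> gap_starts n" "t \<in> gap n l" using t gap_exists[of t] by blast
    then have t: "t \<in> {l..l + 1 / 3 ^ n}" by auto
    show ?thesis
      using a(3)[OF gap_index_pos[OF l(1)] gap_coordinate_inverse[OF t]]
      unfolding ell_tau_gap[OF l(1) t] earring_map_ell[OF gap_index_pos[OF l(1)] gap_coordinate_inverse[OF t]] .
  qed
  with a show ?thesis by (rule that)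
qed

text \<open>The maps \<open>a\<close> and \<open>b\<close> that see only the odd and only the even circles under \<open>f\<close> differ on \<open>c_elt n\<close> by
  the image of \<open>p_elt n\<close>, and on the class of \<open>ell_tau\<close> by the image of \<open>p_tau\<close>.\<close>

lemma transfinite_products_imp_closed:
  assumes tp: "transfinite_products_rel X x H" and x: "x \<in> X"
    and H: "subgroup H (fundamental_group X x)"
  shows "closed_subgroup earring_plus earring_plus_base P_subgroup p_tau X x H"
  unfolding closed_subgroup_def
proof (intro allI impI, elim conjE)
  fix f assume f: "based_map earring_plus earring_plus_base X x f" and P: "induced_hom X f ` P_subgroup \<subseteq> H"
  let ?G = "fundamental_group X x"
  let ?\<omega> = "f \<circ> whisker"
  interpret tail X x "f (0, 0)" ?\<omega> using tail_image_map[OF tail_whisker f] .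
  have le_double: "m \<le> 2 * m - 1" "m \<le> 2 * m" if "m \<ge> 1" for m :: nat using that by auto
  obtain a where a: "based_map earring_plus earring_plus_base X x a"
    "\<And>t. t \<in> {0..1} \<Longrightarrow> a (whisker t) = f (whisker t)"
    "\<And>n t. n \<ge> 1 \<Longrightarrow> t \<in> {0..1} \<Longrightarrow> a (ell n t) = f (ell (2 * n - 1) t)"
    "\<And>t. t \<in> {0..1} \<Longrightarrow> a (ell_tau t) = f (f_odd (ell_tau t))"
    using precompose_circle_map[OF f, of "\<lambda>n. 2 * n - 1"] le_double unfolding f_odd_def by metis
  obtain b where b: "based_map earring_plus earring_plus_base X x b"
    "\<And>t. t \<in> {0..1} \<Longrightarrow> b (whisker t) = f (whisker t)"
    "\<And>n t. n \<ge> 1 \<Longrightarrow> t \<in> {0..1} \<Longrightarrow> b (ell n t) = f (ell (2 * n) t)"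
    "\<And>t. t \<in> {0..1} \<Longrightarrow> b (ell_tau t) = f (f_even (ell_tau t))"
    using precompose_circle_map[OF f, of "\<lambda>n. 2 * n"] le_double unfolding f_even_def by metis
  have plus: "p \<in> based_loops earring (0, 0) \<Longrightarrow> p \<in> based_loops earring_plus (0, 0)" for p
    using based_loops_mono[OF earring_subset_plus] by blast
  have image: "f \<circ> p \<in> based_loops X (f (0, 0))" if "p \<in> based_loops earring_plus (0, 0)" for p
    using that f by (intro based_loops_image) (auto simp: based_map_def)
  have induced: "induced_hom X d (whisker_class p) = lasso X ?\<omega> (f \<circ> q)"
    if "p \<in> based_loops earring_plus (0, 0)" "based_map earring_plus earring_plus_base X x d"
      "\<And>t. t \<in> {0..1} \<Longrightarrow> d (whisker t) = f (whisker t)" "\<And>t. t \<in> {0..1} \<Longrightarrow> d (p t) = f (q t)" for p q d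
    unfolding whisker_class_lasso induced_hom_lasso[OF tail_whisker that(2,1)]
    using that(3,4) by (intro lasso_cong_on) auto
  have quotient: "lasso X ?\<omega> (f \<circ> p) \<otimes>\<^bsub>?G\<^esub> inv\<^bsub>?G\<^esub> lasso X ?\<omega> (f \<circ> q) = induced_hom X f (whisker_class (p +++ reversepath q))"
    if "p \<in> based_loops earring_plus (0, 0)" "q \<in> based_loops earring_plus (0, 0)" for p q
  proof -
    have "induced_hom X f (whisker_class (p +++ reversepath q)) = lasso X ?\<omega> (f \<circ> (p +++ reversepath q))"
      using that f by (intro induced) (auto intro: based_loops_join based_loops_reversepath)
    then show ?thesis
      using that by (simp add: path_compose_join path_compose_reversepath lasso_join_reversepath image)
  qed
  have "\<forall>n\<ge>1. H #>\<^bsub>?G\<^esub> induced_hom X a (c_elt n) = H #>\<^bsub>?G\<^esub> induced_hom X b (c_elt n)"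
  proof (intro allI impI)
    fix n :: nat assume n: "n \<ge> 1"
    have e: "ell n \<in> based_loops earring_plus (0, 0)" "ell (2 * n - 1) \<in> based_loops earring_plus (0, 0)"
      "ell (2 * n) \<in> based_loops earring_plus (0, 0)"
      using n by (auto intro!: plus ell_loop)
    have ab: "induced_hom X a (c_elt n) = lasso X ?\<omega> (f \<circ> ell (2 * n - 1))"
      "induced_hom X b (c_elt n) = lasso X ?\<omega> (f \<circ> ell (2 * n))"
      unfolding c_elt_def by (rule induced[OF e(1) a(1,2) a(3)[OF n]] induced[OF e(1) b(1,2) b(3)[OF n]]; assumption)+
    have "p_elt n \<in> P_subgroup" unfolding P_subgroup_def using n by (auto intro: generate.incl)
    then have "lasso X ?\<omega> (f \<circ> ell (2 * n - 1)) \<otimes>\<^bsub>?G\<^esub> inv\<^bsub>?G\<^esub> lasso X ?\<omega> (f \<circ> ell (2 * n)) \<in> H"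
      unfolding quotient[OF e(2,3)] using P by (auto simp: p_elt_def)
    then show "H #>\<^bsub>?G\<^esub> induced_hom X a (c_elt n) = H #>\<^bsub>?G\<^esub> induced_hom X b (c_elt n)"
      unfolding ab using e by (intro rcoset_eq_iff[THEN iffD2] G.is_group H lasso_carrier image)
  qed
  moreover have "whisker_class ell_tau \<in> carrier (fundamental_group earring_plus earring_plus_base)"
    unfolding whisker_class_lasso by (intro tail.lasso_carrier[OF tail_whisker] plus ell_tau_loop)
  ultimately have "H #>\<^bsub>?G\<^esub> induced_hom X a (whisker_class ell_tau) = H #>\<^bsub>?G\<^esub> induced_hom X b (whisker_class ell_tau)"
    using tp a(1,2) b(1,2) unfolding transfinite_products_rel_def by metis
  moreover have "induced_hom X a (whisker_class ell_tau) = lasso X ?\<omega> (f \<circ> (f_odd \<circ> ell_tau))"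
    "induced_hom X b (whisker_class ell_tau) = lasso X ?\<omega> (f \<circ> (f_even \<circ> ell_tau))"
    by (rule induced[OF plus[OF ell_tau_loop] a(1,2)] induced[OF plus[OF ell_tau_loop] b(1,2)]; simp add: a(4) b(4))+
  ultimately have "lasso X ?\<omega> (f \<circ> (f_odd \<circ> ell_tau)) \<otimes>\<^bsub>?G\<^esub> inv\<^bsub>?G\<^esub> lasso X ?\<omega> (f \<circ> (f_even \<circ> ell_tau)) \<in> H"
    using rcoset_eq_iff[OF G.is_group H] lasso_carrier image f_odd_ell_tau_loop f_even_ell_tau_loop by metis
  then show "induced_hom X f p_tau \<in> H"
    unfolding quotient[OF f_odd_ell_tau_loop f_even_ell_tau_loop] p_tau_def .
qed

section \<open>Fitting the Cantor set onto a closed set\<close>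

text \<open>For a closed set \<open>K\<close> and \<open>u \<le> v\<close> in \<open>K\<close>, a continuous map from \<open>[0,1]\<close> to \<open>[u,v]\<close> is built that sends the
  Cantor set into \<open>K\<close> and each of its gaps linearly onto a gap of \<open>K\<close> or to a point of \<open>K\<close>. The gap of \<open>K\<close> that
  contains the midpoint of \<open>[u,v]\<close> is assigned to the middle third; when the midpoint belongs to \<open>K\<close>,
  the middle third is sent there. The construction continues on the two outer thirds with the
  remaining parts of \<open>[u,v]\<close>, which are at most half as long.\<close>

locale closed_set_of_reals =
  fixes K :: "real set"
  assumes closed_K: "closed K"
begin

definition lower :: "real \<Rightarrow> real \<Rightarrow> real" where
  "lower u v = Sup (K \<inter> {u..(u + v) / 2})"

definition upper :: "real \<Rightarrow> real \<Rightarrow> real" where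
  "upper u v = Inf (K \<inter> {(u + v) / 2..v})"

lemma lower_upper:
  assumes "u \<in> K" "v \<in> K" "u \<le> v"
  shows "lower u v \<in> K" "upper u v \<in> K" "u \<le> lower u v" "lower u v \<le> (u + v) / 2"
    "(u + v) / 2 \<le> upper u v" "upper u v \<le> v" "K \<inter> {lower u v<..<upper u v} = {}"
proof -
  let ?L = "K \<inter> {u..(u + v) / 2}" and ?U = "K \<inter> {(u + v) / 2..v}"
  have ne: "?L \<noteq> {}" "?U \<noteq> {}" and bdd: "bdd_above ?L" "bdd_below ?U"
    using assms by auto
  have "lower u v \<in> ?L" unfolding lower_def
    using ne bdd closed_K by (intro closed_contains_Sup) auto
  moreover have "upper u v \<in> ?U" unfolding upper_def
    using ne bdd closed_K by (intro closed_contains_Inf) auto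
  ultimately show "lower u v \<in> K" "upper u v \<in> K" "u \<le> lower u v" "lower u v \<le> (u + v) / 2"
    "(u + v) / 2 \<le> upper u v" "upper u v \<le> v" by auto
  show "K \<inter> {lower u v<..<upper u v} = {}"
  proof (rule ccontr)
    assume "K \<inter> {lower u v<..<upper u v} \<noteq> {}"
    then obtain z where z: "z \<in> K" "lower u v < z" "z < upper u v" by auto
    have "u \<le> z" "z \<le> v"
      using z \<open>lower u v \<in> ?L\<close> \<open>upper u v \<in> ?U\<close> by auto
    then have "z \<in> ?L \<or> z \<in> ?U" using z(1) by auto
    then show False
      using z(2,3) cSup_upper[OF _ bdd(1), of z] cInf_lower[OF _ bdd(2), of z]
      by (auto simp: lower_def upper_def)
  qed
qed

text \<open>Stage \<open>n\<close> of the construction, linear on the intervals that have not been subdivided yet.\<close>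

fun approx :: "nat \<Rightarrow> real \<Rightarrow> real \<Rightarrow> real \<Rightarrow> real" where
  "approx 0 u v t = u + t * (v - u)"
| "approx (Suc n) u v t =
    (if t \<le> 1 / 3 then approx n u (lower u v) (3 * t)
     else if t < 2 / 3 then lower u v + (3 * t - 1) * (upper u v - lower u v)
     else approx n (upper u v) v (3 * t - 2))"

lemma approx_ends: "approx n u v 0 = u" "approx n u v 1 = v"
  by (induction n arbitrary: u v) auto

lemma approx_range:
  assumes "u \<in> K" "v \<in> K" "u \<le> v" "t \<in> {0..1}"
  shows "approx n u v t \<in> {u..v}"
  using assms
proof (induction n arbitrary: u v t)
  case 0
  then have "0 \<le> t * (v - u)" "t * (v - u) \<le> 1 * (v - u)"
    using mult_right_mono[of t 1 "v - u"] by auto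
  then show ?case by simp
next
  case (Suc n)
  note lu = lower_upper[OF Suc.prems(1-3)]
  consider "t \<le> 1 / 3" | "1 / 3 < t" "t < 2 / 3" | "2 / 3 \<le> t" by linarith
  then show ?case
  proof cases
    case 1
    then have "approx n u (lower u v) (3 * t) \<in> {u..lower u v}"
      using Suc.prems lu by (intro Suc.IH) auto
    then show ?thesis using 1 lu by auto
  next
    case 2
    define w where "w = (3 * t - 1) * (upper u v - lower u v)"
    have "0 \<le> upper u v - lower u v" using lu by linarith
    then have "0 \<le> w" "w \<le> 1 * (upper u v - lower u v)"
      unfolding w_def using 2 by (intro mult_nonneg_nonneg mult_right_mono; simp)+
    moreover have "approx (Suc n) u v t = lower u v + w" using 2 by (simp add: w_def)
    ultimately show ?thesis using lu by simp
  next
    case 3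
    then have "approx n (upper u v) v (3 * t - 2) \<in> {upper u v..v}"
      using Suc.prems lu by (intro Suc.IH) auto
    then show ?thesis using 3 lu by auto
  qed
qed

lemma approx_Suc_middle:
  assumes "1 / 3 \<le> t" "t \<le> 2 / 3"
  shows "approx (Suc n) u v t = lower u v + (3 * t - 1) * (upper u v - lower u v)"
proof -
  consider "t = 1 / 3" | "t = 2 / 3" | "1 / 3 < t" "t < 2 / 3" using assms by linarith
  then show ?thesis
  proof cases
    case 1
    show ?thesis unfolding 1 by (simp add: approx_ends)
  next
    case 2
    show ?thesis unfolding 2 by (simp add: approx_ends)
  qed simp
qed

lemma approx_continuous: "continuous_on {0..1} (approx n u v)"
proof (induction n arbitrary: u v)
  case 0
  show ?case by (auto intro!: continuous_intros)
next
  case (Suc n)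
  let ?m = "\<lambda>t. lower u v + (3 * t - 1) * (upper u v - lower u v)"
  have left: "continuous_on {0..1/3} (\<lambda>t. approx n u (lower u v) (3 * t))"
    by (rule continuous_on_compose2[OF Suc]) (auto intro!: continuous_intros)
  have right: "continuous_on {2/3..1} (\<lambda>t. approx n (upper u v) v (3 * t - 2))"
    by (rule continuous_on_compose2[OF Suc]) (auto intro!: continuous_intros)
  have middle: "continuous_on {1/3..2/3} ?m" by (intro continuous_intros)
  have "continuous_on {0..1/3} (approx (Suc n) u v)"
    using left by (rule continuous_on_eq) auto
  moreover have "continuous_on {1/3..2/3} (approx (Suc n) u v)"
    using middle by (rule continuous_on_eq) (simp add: approx_Suc_middle del: approx.simps)
  moreover have "continuous_on {2/3..1} (approx (Suc n) u v)"
    using right by (rule continuous_on_eq) auto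
  ultimately have "continuous_on (({0..1/3} \<union> {1/3..2/3}) \<union> {2/3..1}) (approx (Suc n) u v)"
    by (intro continuous_on_closed_Un closed_Un) auto
  moreover have "({0..1/3} \<union> {1/3..2/3}) \<union> {2/3..1} = {0..1::real}" by auto
  ultimately show ?case by simp
qed

text \<open>Two consecutive stages differ at a point only within a subinterval of \<open>[u,v]\<close> of length at most
  \<open>(v - u) / 2\<^sup>n\<close> that contains both values.\<close>

lemma approx_Suc_diff:
  assumes "u \<in> K" "v \<in> K" "u \<le> v" "t \<in> {0..1}"
  shows "\<bar>approx (Suc n) u v t - approx n u v t\<bar> \<le> (v - u) / 2 ^ n"
  using assms
proof (induction n arbitrary: u v t)
  case 0
  have "approx (Suc 0) u v t \<in> {u..v}" "approx 0 u v t \<in> {u..v}" by (rule approx_range[OF 0])+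
  then show ?case by (simp add: abs_le_iff del: approx.simps)
next
  case (Suc n)
  note lu = lower_upper[OF Suc.prems(1-3)]
  have half: "x / 2 ^ n \<le> (v - u) / 2 ^ Suc n" if "x \<le> (v - u) / 2" for x
  proof -
    have "x / 2 ^ n \<le> ((v - u) / 2) / 2 ^ n" using that by (intro divide_right_mono) auto
    then show ?thesis by simp
  qed
  consider "t \<le> 1 / 3" | "1 / 3 < t" "t < 2 / 3" | "2 / 3 \<le> t" by linarith
  then show ?case
  proof cases
    case 1
    then have "\<bar>approx (Suc n) u (lower u v) (3 * t) - approx n u (lower u v) (3 * t)\<bar> \<le> (lower u v - u) / 2 ^ n"
      using Suc.prems lu by (intro Suc.IH) auto
    also have "\<dots> \<le> (v - u) / 2 ^ Suc n" using lu(3-6) by (intro half) simp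
    finally have "\<bar>approx (Suc n) u (lower u v) (3 * t) - approx n u (lower u v) (3 * t)\<bar> \<le> (v - u) / 2 ^ Suc n" .
    moreover have "approx (Suc k) u v t = approx k u (lower u v) (3 * t)" for k using 1 by simp
    ultimately show ?thesis by presburger
  next
    case 2
    then show ?thesis using Suc.prems(3) by simp
  next
    case 3
    then have "\<bar>approx (Suc n) (upper u v) v (3 * t - 2) - approx n (upper u v) v (3 * t - 2)\<bar> \<le> (v - upper u v) / 2 ^ n"
      using Suc.prems lu by (intro Suc.IH) auto
    also have "\<dots> \<le> (v - u) / 2 ^ Suc n" using lu(3-6) by (intro half) simp
    finally have "\<bar>approx (Suc n) (upper u v) v (3 * t - 2) - approx n (upper u v) v (3 * t - 2)\<bar> \<le> (v - u) / 2 ^ Suc n" .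
    moreover have "approx (Suc k) u v t = approx k (upper u v) v (3 * t - 2)" for k using 3 by simp
    ultimately show ?thesis by presburger
  qed
qed

definition fit :: "real \<Rightarrow> real \<Rightarrow> real \<Rightarrow> real" where
  "fit u v t = lim (\<lambda>n. approx n u v t)"

lemma approx_uniform_limit:
  assumes "u \<in> K" "v \<in> K" "u \<le> v"
  shows "uniform_limit {0..1} (\<lambda>n. approx n u v) (fit u v) sequentially"
proof -
  have "uniform_limit {0..1} (\<lambda>n t. \<Sum>i<n. approx (Suc i) u v t - approx i u v t)
      (\<lambda>t. \<Sum>i. approx (Suc i) u v t - approx i u v t) sequentially"
  proof (rule Weierstrass_m_test)
    show "norm (approx (Suc n) u v t - approx n u v t) \<le> (v - u) * (1 / 2) ^ n" if "t \<in> {0..1}" for n t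
      using approx_Suc_diff[OF assms that, of n] by (simp add: power_one_over field_simps)
    show "summable (\<lambda>n. (v - u) * (1 / 2) ^ n)" by (intro summable_mult summable_geometric) simp
  qed
  moreover have telescope: "(\<Sum>i<n. approx (Suc i) u v t - approx i u v t) = approx n u v t - approx 0 u v t" for n t
    by (rule sum_lessThan_telescope)
  ultimately have "uniform_limit {0..1} (\<lambda>n t. approx n u v t - approx 0 u v t)
      (\<lambda>t. \<Sum>i. approx (Suc i) u v t - approx i u v t) sequentially"
    by (simp only: telescope)
  then have "uniform_limit {0..1} (\<lambda>n t. (approx n u v t - approx 0 u v t) + approx 0 u v t)
      (\<lambda>t. (\<Sum>i. approx (Suc i) u v t - approx i u v t) + approx 0 u v t) sequentially"
    by (intro uniform_limit_add uniform_limit_const)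
  then have *: "uniform_limit {0..1} (\<lambda>n. approx n u v)
      (\<lambda>t. (\<Sum>i. approx (Suc i) u v t - approx i u v t) + approx 0 u v t) sequentially" by simp
  have "(\<Sum>i. approx (Suc i) u v t - approx i u v t) + approx 0 u v t = fit u v t" if "t \<in> {0..1}" for t
    unfolding fit_def using tendsto_uniform_limitI[OF * that] by (rule limI[symmetric])
  then show ?thesis
    using * uniform_limit_cong'[of "{0..1}" "\<lambda>n. approx n u v" "\<lambda>n. approx n u v", OF refl] by (metis (lifting))
qed

lemma approx_tendsto:
  assumes "u \<in> K" "v \<in> K" "u \<le> v" "t \<in> {0..1}"
  shows "(\<lambda>n. approx n u v t) \<longlonglongrightarrow> fit u v t"
  using tendsto_uniform_limitI[OF approx_uniform_limit[OF assms(1-3)] assms(4)] .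

lemma fit_continuous:
  assumes "u \<in> K" "v \<in> K" "u \<le> v"
  shows "continuous_on {0..1} (fit u v)"
  using approx_uniform_limit[OF assms]
  by (rule uniform_limit_theorem[rotated]) (auto simp: approx_continuous)

lemma fit_range:
  assumes "u \<in> K" "v \<in> K" "u \<le> v" "t \<in> {0..1}"
  shows "fit u v t \<in> {u..v}"
  by (rule closed_sequentially[OF closed_atLeastAtMost _ approx_tendsto[OF assms]])
     (rule approx_range[OF assms])

lemma fit_ends: "fit u v 0 = u" "fit u v 1 = v"
  by (simp_all add: fit_def approx_ends)

lemma fit_left:
  assumes "t \<le> 1 / 3"
  shows "fit u v t = fit u (lower u v) (3 * t)"
proof -
  have "(\<lambda>n. approx (Suc n) u v t) = (\<lambda>n. approx n u (lower u v) (3 * t))" using assms by simp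
  then show ?thesis unfolding fit_def lim_def by (subst filterlim_sequentially_Suc[symmetric]) simp
qed

lemma fit_right:
  assumes "2 / 3 \<le> t"
  shows "fit u v t = fit (upper u v) v (3 * t - 2)"
proof -
  have "(\<lambda>n. approx (Suc n) u v t) = (\<lambda>n. approx n (upper u v) v (3 * t - 2))" using assms by auto
  then show ?thesis unfolding fit_def lim_def by (subst filterlim_sequentially_Suc[symmetric]) simp
qed

lemma fit_middle:
  assumes "1 / 3 \<le> t" "t \<le> 2 / 3"
  shows "fit u v t = lower u v + (3 * t - 1) * (upper u v - lower u v)"
proof -
  have "approx (Suc n) u v t = lower u v + (3 * t - 1) * (upper u v - lower u v)" for n
    using assms by (rule approx_Suc_middle)
  then have "(\<lambda>n. approx (Suc n) u v t) \<longlonglongrightarrow> lower u v + (3 * t - 1) * (upper u v - lower u v)"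
    by simp
  then show ?thesis unfolding fit_def by (intro limI) (rule LIMSEQ_imp_Suc)
qed

text \<open>The limit inherits the recursion of the stages, so a gap of level \<open>n\<close> is traced through \<open>n - 1\<close>
  subdivisions to the middle third of some pair of points of \<open>K\<close>.\<close>

lemma fit_gap:
  assumes "l \<in> gap_starts n" "u \<in> K" "v \<in> K" "u \<le> v"
  shows "\<exists>p q. p \<in> K \<and> q \<in> K \<and> p \<le> q \<and> K \<inter> {p<..<q} = {} \<and>
    (\<forall>s\<in>{0..1}. fit u v (l + s / 3 ^ n) = p + s * (q - p))"
  using assms
proof (induction n arbitrary: l u v rule: gap_starts.induct)
  case 2
  have l: "l = 1 / 3" using 2(1) by simp
  have "fit u v (l + s / 3 ^ Suc 0) = lower u v + s * (upper u v - lower u v)" if "s \<in> {0..1}" for s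
    unfolding l using that fit_middle[of "1 / 3 + s / 3" u v] by simp
  moreover have "lower u v \<le> upper u v" using lower_upper[OF 2(2-4)] by linarith
  ultimately show ?case using lower_upper[OF 2(2-4)] by blast
next
  case (3 n)
  note lu = lower_upper[OF "3.prems"(2-4)]
  have third: "3 * (s / 3 ^ Suc (Suc n)) = s / 3 ^ Suc n" for s :: real by simp
  have e: "s / 3 ^ Suc (Suc n) \<le> 1 / 3 ^ Suc (Suc n)" "0 \<le> s / 3 ^ Suc (Suc n)" if "s \<in> {0..1}" for s :: real
    using that by (auto intro: divide_right_mono)
  from "3.prems"(1) show ?case
  proof (cases rule: gap_starts_cases)
    case left
    have "fit u v (l + s / 3 ^ Suc (Suc n)) = fit u (lower u v) (3 * l + s / 3 ^ Suc n)" if "s \<in> {0..1}" for s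
      using left(2) e[OF that] fit_left[of "l + s / 3 ^ Suc (Suc n)" u v] third[of s]
      by (simp only: distrib_left)
    then show ?thesis using "3.IH"(1)[of "3 * l" u "lower u v"] left(1) "3.prems" lu by simp
  next
    case right
    have "fit u v (l + s / 3 ^ Suc (Suc n)) = fit (upper u v) v ((3 * l - 2) + s / 3 ^ Suc n)" if "s \<in> {0..1}" for s
    proof -
      have "3 * (l + s / 3 ^ Suc (Suc n)) - 2 = (3 * l - 2) + s / 3 ^ Suc n"
        using third[of s] by (simp only: distrib_left)
      moreover have "2 / 3 \<le> l + s / 3 ^ Suc (Suc n)" using right(2) e(2)[OF that] by linarith
      ultimately show ?thesis using fit_right by metis
    qed
    then show ?thesis using "3.IH"(1)[of "3 * l - 2" "upper u v" v] right(1) "3.prems" lu by simp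
  qed
qed simp

text \<open>After \<open>n\<close> subdivisions a point of the Cantor set still lies in an interval whose ends are sent into
  \<open>K\<close> and whose image is short. Passing to the limit puts its image into \<open>K\<close>.\<close>

lemma approx_near_K:
  assumes "u \<in> K" "v \<in> K" "u \<le> v" "t \<in> cantor_set"
  shows "\<exists>z\<in>K. \<bar>approx n u v t - z\<bar> \<le> (v - u) / 2 ^ n"
  using assms
proof (induction n arbitrary: u v t)
  case 0
  then show ?case using approx_range[OF 0(1-3), of t 0] cantor_set_subset by (intro bexI[of _ u]) auto
next
  case (Suc n)
  note lu = lower_upper[OF Suc.prems(1-3)]
  have half: "x / 2 ^ n \<le> (v - u) / 2 ^ Suc n" if "x \<le> (v - u) / 2" for x
  proof -
    have "x / 2 ^ n \<le> ((v - u) / 2) / 2 ^ n" using that by (intro divide_right_mono) auto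
    then show ?thesis by simp
  qed
  consider "t \<le> 1 / 3" | "2 / 3 \<le> t"
    using cantor_set_middle[of t] Suc.prems(4) by force
  then show ?case
  proof cases
    case 1
    then have "3 * t \<in> cantor_set" using cantor_set_left[of t] Suc.prems(4) by simp
    then obtain z where "z \<in> K" "\<bar>approx n u (lower u v) (3 * t) - z\<bar> \<le> (lower u v - u) / 2 ^ n"
      using Suc.IH[OF Suc.prems(1) lu(1,3)] by blast
    moreover have "(lower u v - u) / 2 ^ n \<le> (v - u) / 2 ^ Suc n" using lu(3-6) by (intro half) simp
    moreover have "approx (Suc n) u v t = approx n u (lower u v) (3 * t)" using 1 by simp
    ultimately show ?thesis by (metis order_trans)
  next
    case 2
    then have "3 * t - 2 \<in> cantor_set" using cantor_set_right[of t] Suc.prems(4) by simp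
    then obtain z where "z \<in> K" "\<bar>approx n (upper u v) v (3 * t - 2) - z\<bar> \<le> (v - upper u v) / 2 ^ n"
      using Suc.IH[OF lu(2) Suc.prems(2) lu(6)] by blast
    moreover have "(v - upper u v) / 2 ^ n \<le> (v - u) / 2 ^ Suc n" using lu(3-6) by (intro half) simp
    moreover have "approx (Suc n) u v t = approx n (upper u v) v (3 * t - 2)" using 2 by simp
    ultimately show ?thesis by (metis order_trans)
  qed
qed

lemma fit_cantor:
  assumes "u \<in> K" "v \<in> K" "u \<le> v" "t \<in> cantor_set"
  shows "fit u v t \<in> K"
proof -
  obtain z where z: "\<And>n. z n \<in> K" "\<And>n. \<bar>approx n u v t - z n\<bar> \<le> (v - u) / 2 ^ n"
    using approx_near_K[OF assms] by metis
  have null: "(\<lambda>n. (v - u) * (1 / 2) ^ n) \<longlonglongrightarrow> 0"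
    by (intro tendsto_mult_right_zero LIMSEQ_power_zero) simp
  have bound: "norm (approx n u v t - z n) \<le> (v - u) * (1 / 2) ^ n" for n
    using z(2)[of n] by (simp add: power_one_over)
  have "(\<lambda>n. approx n u v t - z n) \<longlonglongrightarrow> 0"
    by (rule Lim_null_comparison[OF _ null]) (simp only: bound eventually_True)
  moreover have "(\<lambda>n. approx n u v t) \<longlonglongrightarrow> fit u v t"
    using assms cantor_set_subset by (intro approx_tendsto) auto
  ultimately have "(\<lambda>n. approx n u v t - (approx n u v t - z n)) \<longlonglongrightarrow> fit u v t - 0"
    by (intro tendsto_diff)
  then have "z \<longlonglongrightarrow> fit u v t" by simp
  then show ?thesis using closed_K z(1) closed_sequentially by blast
qed

end

section \<open>Loops in the earring\<close>

lemma ell_periodic: "ell n (of_int k + t) = ell n t"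
proof -
  have "2 * pi * (of_int k + t) = 2 * pi * t + 2 * pi * of_int k" by (simp add: algebra_simps)
  then have "sin (2 * pi * (of_int k + t)) = sin (2 * pi * t) \<and> cos (2 * pi * (of_int k + t)) = cos (2 * pi * t)"
    unfolding sin_cos_eq_iff by blast
  then show ?thesis by (simp add: ell_def)
qed

lemma ell_eq_0_imp_int:
  assumes "n \<ge> 1" "ell n t = (0, 0)"
  obtains k :: int where "t = of_int k"
proof -
  have "cos (2 * pi * t) = 1" using assms by (simp add: ell_def)
  then obtain k :: int where "2 * pi * t = k * 2 * pi" by (auto simp: cos_one_2pi_int)
  then show ?thesis using that[of k] by simp
qed

text \<open>Translated and scaled to the unit circle of the complex plane, the path has a continuous logarithm;
  its imaginary part is the angle.\<close>

lemma circle_path_lift: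
  assumes n: "n \<ge> 1" and \<kappa>: "path \<kappa>" "path_image \<kappa> \<subseteq> earring_circle n"
  obtains \<theta> :: "real \<Rightarrow> real" where "path \<theta>" "\<And>t. t \<in> {0..1} \<Longrightarrow> \<kappa> t = ell n (\<theta> t)"
proof -
  define z where "z t = Complex (1 - n * fst (\<kappa> t)) (- (n * snd (\<kappa> t)))" for t
  have norm_z: "cmod (z t) = 1" if t: "t \<in> {0..1}" for t
  proof -
    have "(fst (\<kappa> t), snd (\<kappa> t)) \<in> earring_circle n" using t \<kappa>(2) by (auto simp: path_image_def)
    then have "real n * ((fst (\<kappa> t))\<^sup>2 + (snd (\<kappa> t))\<^sup>2) = 2 * fst (\<kappa> t)"
      by (simp only: mem_earring_circle[OF n])
    then have "real n * (real n * ((fst (\<kappa> t))\<^sup>2 + (snd (\<kappa> t))\<^sup>2)) = real n * (2 * fst (\<kappa> t))" by simp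
    then have "(1 - n * fst (\<kappa> t))\<^sup>2 + (- (n * snd (\<kappa> t)))\<^sup>2 = 1"
      by (simp add: power2_eq_square algebra_simps)
    then show ?thesis by (simp add: z_def cmod_def)
  qed
  have "continuous_on {0..1} z"
    using \<kappa>(1) unfolding z_def path_def by (intro continuous_intros)
  moreover have "z t \<noteq> 0" if "t \<in> {0..1}" for t using norm_z[OF that] by auto
  ultimately obtain g where g: "continuous_on {0..1} g" "\<And>t. t \<in> {0..1} \<Longrightarrow> z t = exp (g t)"
    using continuous_logarithm_on_contractible[of "{0..1}" z] convex_imp_contractible[of "{0..1::real}"] by auto
  define \<theta> where "\<theta> t = Im (g t) / (2 * pi)" for t
  have "path \<theta>" unfolding path_def \<theta>_def using g(1) by (intro continuous_intros) auto
  moreover have "\<kappa> t = ell n (\<theta> t)" if t: "t \<in> {0..1}" for t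
  proof -
    have "exp (Re (g t)) = 1" using norm_z[OF t] g(2)[OF t] by (simp add: norm_exp_eq_Re)
    then have "z t = Complex (cos (2 * pi * \<theta> t)) (sin (2 * pi * \<theta> t))"
      using g(2)[OF t] by (simp add: \<theta>_def complex_eq_iff Re_exp Im_exp)
    then have "1 - n * fst (\<kappa> t) = cos (2 * pi * \<theta> t)" "- (n * snd (\<kappa> t)) = sin (2 * pi * \<theta> t)"
      by (auto simp: z_def)
    then show ?thesis
      unfolding ell_def using n by (intro prod_eqI) (simp_all add: field_simps)
  qed
  ultimately show ?thesis by (rule that)
qed

text \<open>The lifted angle starts and ends at integers and meets no integer in between, so the ends differ by
  at most \<open>1\<close>. The straight homotopy from the angle to the linear function with the same ends then
  deforms the excursion into a loop that runs once around the circle, in either direction, or stays put.\<close>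

lemma circle_excursion_homotopic:
  assumes n: "n \<ge> 1" and \<kappa>: "\<kappa> \<in> based_loops (earring_circle n) (0, 0)"
    and inner: "\<And>t. t \<in> {0<..<1} \<Longrightarrow> \<kappa> t \<noteq> (0, 0)"
  shows "\<exists>q\<in>{\<lambda>_. (0, 0), ell n, reversepath (ell n)}. homotopic_paths (earring_circle n) \<kappa> q"
proof -
  obtain \<theta> where \<theta>: "path \<theta>" "\<And>t. t \<in> {0..1} \<Longrightarrow> \<kappa> t = ell n (\<theta> t)"
    using circle_path_lift[OF n] based_loopsD(1,2)[OF \<kappa>] by metis
  have "\<kappa> 0 = (0, 0)" "\<kappa> 1 = (0, 0)" using \<kappa> by (auto simp: based_loops_def pathstart_def pathfinish_def)
  then obtain i j :: int where i: "\<theta> 0 = i" and j: "\<theta> 1 = j"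
    using \<theta>(2)[of 0] \<theta>(2)[of 1] ell_eq_0_imp_int[OF n] by (metis atLeastAtMost_iff order_refl zero_le_one)
  have not_int: "\<theta> t \<noteq> of_int k" if "t \<in> {0<..<1}" for t k
    using inner[OF that] \<theta>(2)[of t] that ell_periodic[of n k 0] by auto
  have cont: "continuous_on {0..1} \<theta>" using \<theta>(1) by (simp add: path_def)
  \<comment> \<open>By the intermediate value theorem no integer lies strictly between the two end values.\<close>
  have no_cross: "\<not> (min i j < k \<and> k < max i j)" for k :: int
  proof
    assume k: "min i j < k \<and> k < max i j"
    have "\<exists>t\<in>{0..1}. \<theta> t = of_int k"
    proof (cases "i \<le> j")
      case True
      then show ?thesis using IVT'[of \<theta> 0 "of_int k" 1] cont i j k by auto
    next
      case False
      then show ?thesis using IVT2'[of \<theta> 1 "of_int k" 0] cont i j k by auto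
    qed
    then obtain t where t: "t \<in> {0..1}" "\<theta> t = of_int k" by blast
    then have "t = 0 \<or> t = 1" using not_int[of t k] by force
    then show False using t(2) i j k by auto
  qed
  have ij: "j - i = 0 \<or> j - i = 1 \<or> j - i = - 1"
    using no_cross[of "i + 1"] no_cross[of "i - 1"] by (auto simp: min_def max_def split: if_splits)
  define \<sigma> where "\<sigma> t = of_int i + t * of_int (j - i)" for t :: real
  have "homotopic_paths UNIV \<theta> \<sigma>"
    using \<theta>(1) i j
    by (intro homotopic_paths_linear)
       (auto simp: path_def \<sigma>_def pathstart_def pathfinish_def intro!: continuous_intros)
  then have "homotopic_paths (earring_circle n) (ell n \<circ> \<theta>) (ell n \<circ> \<sigma>)"
  proof (rule homotopic_paths_continuous_image)
    show "continuous_on UNIV (ell n)" unfolding ell_def using n by (intro continuous_intros) auto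
  qed (use ell_in_circle[OF n] in auto)
  moreover have "homotopic_paths (earring_circle n) \<kappa> (ell n \<circ> \<theta>)"
    using \<theta>(2) by (intro homotopic_paths_eq based_loopsD[OF \<kappa>]) simp
  ultimately have hom: "homotopic_paths (earring_circle n) \<kappa> (ell n \<circ> \<sigma>)"
    using homotopic_paths_trans by blast
  have "ell n \<circ> \<sigma> = (\<lambda>t. ell n (t * of_int (j - i)))"
    by (simp add: \<sigma>_def fun_eq_iff ell_periodic)
  moreover have "reversepath (ell n) = (\<lambda>t. ell n (- t))"
    using ell_periodic[of n 1 "- t" for t] by (simp add: reversepath_def fun_eq_iff)
  ultimately show ?thesis using hom ij by (elim disjE) simp_all
qed

lemma earring_circle_Int:
  assumes "z \<in> earring_circle n" "z \<in> earring_circle m" "n \<ge> 1" "m \<ge> 1" "n \<noteq> m"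
  shows "z = (0, 0)"
proof -
  obtain s t where "s \<in> {0..1}" "t \<in> {0..1}" "z = ell n s" "z = ell m t"
    using assms ell_image by (metis imageE)
  then show ?thesis using ell_eq_cases[of n s m t] assms by auto
qed

text \<open>Away from the origin each circle is open and closed in the earring, and the inner part of the
  excursion is connected.\<close>

lemma earring_excursion_in_circle:
  assumes \<kappa>: "\<kappa> \<in> based_loops earring (0, 0)" and inner: "\<And>t. t \<in> {0<..<1} \<Longrightarrow> \<kappa> t \<noteq> (0, 0)"
  obtains n where "n \<ge> 1" "\<kappa> \<in> based_loops (earring_circle n) (0, 0)"
proof -
  let ?S = "\<kappa> ` {0<..<1}"
  have S: "?S \<subseteq> earring" "\<kappa> ` {0..1} = insert (0, 0) ?S"
  proof -
    show "?S \<subseteq> earring" using based_loopsD(2)[OF \<kappa>] by (auto simp: path_image_def)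
    have "{0..1} = {0, 1} \<union> {0<..<1::real}" by auto
    then show "\<kappa> ` {0..1} = insert (0, 0) ?S"
      using based_loopsD(3,4)[OF \<kappa>] by (auto simp: pathstart_def pathfinish_def)
  qed
  have conn: "connected ?S"
    using based_loopsD(1)[OF \<kappa>] unfolding path_def
    by (intro connected_continuous_image) (auto elim: continuous_on_subset)
  have half: "\<kappa> (1 / 2) \<in> ?S" by simp
  then obtain n where n: "n \<ge> 1" "\<kappa> (1 / 2) \<in> earring_circle n"
    using subsetD[OF S(1) half] by (auto simp: earring_def)
  define B where "B = insert (0, 0) (\<Union>m\<in>{1..}. if m = n then {} else earring_circle m)"
  have "closed B" unfolding B_def by (rule closed_Union_earring_subsets) (auto simp: earring_circle_def)
  moreover have "closed (earring_circle n)" by (simp add: earring_circle_def)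
  moreover have "?S \<subseteq> earring_circle n \<union> B"
    using S(1) by (auto simp: earring_def B_def subset_iff)
  moreover have "earring_circle n \<inter> B \<inter> ?S = {}"
  proof -
    have "\<kappa> t \<notin> B" if t: "t \<in> {0<..<1}" "\<kappa> t \<in> earring_circle n" for t
    proof
      assume "\<kappa> t \<in> B"
      then obtain m where "m \<ge> 1" "m \<noteq> n" "\<kappa> t \<in> earring_circle m"
        using inner[OF t(1)] by (auto simp: B_def split: if_splits)
      then show False using earring_circle_Int[of "\<kappa> t" n m] t n(1) inner[OF t(1)] by simp
    qed
    note not_B = this
    show ?thesis
    proof (rule equals0I)
      fix z assume z: "z \<in> earring_circle n \<inter> B \<inter> ?S"
      then obtain t where "t \<in> {0<..<1}" "z = \<kappa> t" by (elim IntE imageE)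
      then show False using not_B[of t] z by simp
    qed
  qed
  moreover have "earring_circle n \<inter> ?S \<noteq> {}" using half n(2) by blast
  ultimately have "B \<inter> ?S = {}" using connected_closedD[OF conn, of "earring_circle n" B] by metis
  then have "?S \<subseteq> earring_circle n" using \<open>?S \<subseteq> earring_circle n \<union> B\<close> by blast
  moreover have "(0, 0) \<in> earring_circle n" using ell_in_circle[OF n(1), of 0] by simp
  ultimately have "path_image \<kappa> \<subseteq> earring_circle n" using S(2) by (simp add: path_image_def)
  then show ?thesis using that[OF n(1)] \<kappa> by (simp add: based_loops_def)
qed

text \<open>On the earring the first coordinate is nonnegative, so this collapses the whisker to the origin and
  fixes everything else.\<close>

definition earring_retraction :: "real \<times> real \<Rightarrow> real \<times> real" where
  "earring_retraction z = (max 0 (fst z), snd z)"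

lemma earring_fst_nonneg: "z \<in> earring \<Longrightarrow> 0 \<le> fst z"
proof -
  assume "z \<in> earring"
  then obtain n where n: "n \<ge> 1" "(fst z, snd z) \<in> earring_circle n" by (auto simp: earring_def)
  then have "real n * ((fst z)\<^sup>2 + (snd z)\<^sup>2) = 2 * fst z" by (simp only: mem_earring_circle)
  moreover have "0 \<le> real n * ((fst z)\<^sup>2 + (snd z)\<^sup>2)" by simp
  ultimately show ?thesis by linarith
qed

text \<open>Sliding the whisker into the origin deforms \<open>\<gamma>\<close> into its retraction while the base point runs along the
  whisker. As a map \<open>F\<close> on the unit square, this deformation carries the left edge to \<open>\<gamma>\<close> and the other
  three edges to the lasso around the retraction. In the square, which is convex, the left edge
  is homotopic to the way around through the other three.\<close>

lemma earring_plus_loop_deform: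
  assumes \<gamma>: "\<gamma> \<in> based_loops earring_plus earring_plus_base"
  shows "earring_retraction \<circ> \<gamma> \<in> based_loops earring (0, 0)"
    and "path_class earring_plus \<gamma> = whisker_class (earring_retraction \<circ> \<gamma>)"
proof -
  note G = based_loopsD[OF \<gamma>]
  have \<gamma>01: "\<gamma> 0 = (- 1, 0)" "\<gamma> 1 = (- 1, 0)"
    using G(3,4) by (auto simp: pathstart_def pathfinish_def earring_plus_base_def)
  have split: "z \<in> earring \<and> 0 \<le> fst z \<or> (\<exists>u\<in>{-1..0}. z = (u, 0))" if "z \<in> earring_plus" for z
    using that earring_fst_nonneg[of z] by (auto simp: earring_plus_def)
  have \<gamma>_in: "\<gamma> t \<in> earring_plus" if "t \<in> {0..1}" for t
    using G(2) that by (auto simp: path_image_def)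
  have "earring_retraction z \<in> earring" if "z \<in> earring_plus" for z
    using split[OF that] origin_in_earring by (auto simp: earring_retraction_def)
  moreover have "continuous_on {0..1} (earring_retraction \<circ> \<gamma>)"
    using G(1) unfolding earring_retraction_def comp_def path_def by (intro continuous_intros)
  ultimately show "earring_retraction \<circ> \<gamma> \<in> based_loops earring (0, 0)"
    using \<gamma>_in \<gamma>01
    by (auto simp: based_loops_def path_def path_image_def pathstart_def pathfinish_def)
       (auto simp: earring_retraction_def)
  define F where "F x = (max (fst (\<gamma> (snd x))) (fst x - 1), snd (\<gamma> (snd x)))" for x :: "real \<times> real"
  let ?Q = "{0..1} \<times> {0..1} :: (real \<times> real) set"
  let ?p = "(\<lambda>t. (t, 0)) +++ (\<lambda>t. (1, t)) +++ reversepath (\<lambda>t. (t, 1)) :: real \<Rightarrow> real \<times> real"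
  have edges: "path (\<lambda>t. (0::real, t::real))" "path (\<lambda>t. (1::real, t::real))"
    "path (\<lambda>t. (t::real, 0::real))" "path (\<lambda>t. (t::real, 1::real))"
    by (auto simp: path_def intro!: continuous_intros)
  have "path ?p"
    by (intro path_join_imp edges path_reversepath[THEN iffD2])
       (simp_all add: pathstart_def pathfinish_def reversepath_def joinpaths_def)
  moreover have "path_image ?p \<subseteq> ?Q"
    by (auto simp: path_image_def joinpaths_def reversepath_def)
  ultimately have p: "path ?p" "path_image ?p \<subseteq> ?Q" by blast+
  have "homotopic_paths ?Q (\<lambda>t. (0, t)) ?p"
  proof (rule homotopic_paths_linear)
    show "closed_segment (0, t) (?p t) \<subseteq> ?Q" if "t \<in> {0..1}" for t
      using p(2) that by (intro closed_segment_subset convex_Times) (auto simp: path_image_def)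
  qed (use p edges in \<open>auto simp: pathstart_def pathfinish_def reversepath_def joinpaths_def\<close>)
  moreover have "continuous_on ?Q F"
  proof -
    have "continuous_on ?Q (\<lambda>x. \<gamma> (snd x))"
      by (rule continuous_on_compose2[OF G(1)[unfolded path_def]]) (auto intro!: continuous_intros)
    then show ?thesis unfolding F_def by (intro continuous_intros)
  qed
  moreover have "F \<in> ?Q \<rightarrow> earring_plus"
  proof
    fix x assume "x \<in> ?Q"
    then have x: "fst x \<in> {0..1}" "snd x \<in> {0..1}" by auto
    from split[OF \<gamma>_in[OF x(2)]] show "F x \<in> earring_plus"
    proof
      assume *: "\<gamma> (snd x) \<in> earring \<and> 0 \<le> fst (\<gamma> (snd x))"
      then have "F x = \<gamma> (snd x)" using x by (auto simp: F_def max_def intro: prod_eqI)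
      then show ?thesis using \<gamma>_in[OF x(2)] by simp
    next
      assume "\<exists>u\<in>{-1..0}. \<gamma> (snd x) = (u, 0)"
      then show ?thesis using x by (auto simp: F_def earring_plus_def)
    qed
  qed
  ultimately have "homotopic_paths earring_plus (F \<circ> (\<lambda>t. (0, t))) (F \<circ> ?p)"
    by (rule homotopic_paths_continuous_image)
  then have "path_class earring_plus (F \<circ> (\<lambda>t. (0, t))) = path_class earring_plus (F \<circ> ?p)"
    by (rule path_class_eq)
  moreover have "path_class earring_plus (F \<circ> (\<lambda>t. (0, t))) = path_class earring_plus \<gamma>"
  proof (rule path_class_cong)
    fix t :: real assume "t \<in> {0..1}"
    then have "- 1 \<le> fst (\<gamma> t)" using split[OF \<gamma>_in] by force
    then show "(F \<circ> (\<lambda>t. (0, t))) t = \<gamma> t" by (auto simp: F_def intro: prod_eqI)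
  qed
  moreover have "path_class earring_plus (F \<circ> ?p) = whisker_class (earring_retraction \<circ> \<gamma>)"
    unfolding whisker_class_def
    using \<gamma>01 by (intro path_class_cong)
      (auto simp: joinpaths_def reversepath_def F_def whisker_def earring_retraction_def max.commute)
  ultimately show "path_class earring_plus \<gamma> = whisker_class (earring_retraction \<circ> \<gamma>)" by simp
qed

section \<open>Closure gives transfinite products\<close>

text \<open>Elements that are congruent modulo a normal subgroup have congruent inverses. Normality matters, since
  the inverses of the elements of a right coset form a left coset.\<close>

lemma (in group) normal_quotient_inverse:
  assumes "N \<lhd> G" "a \<in> carrier G" "b \<in> carrier G" "a \<otimes> inv b \<in> N"
  shows "inv a \<otimes> b \<in> N"
proof -
  interpret normal N G by fact
  have "inv a \<otimes> inv (a \<otimes> inv b) \<otimes> a \<in> N"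
    using inv_op_closed1[of a "inv (a \<otimes> inv b)"] assms(2,4) m_inv_closed by simp
  moreover have "inv a \<otimes> inv (a \<otimes> inv b) \<otimes> a = inv a \<otimes> b"
    using assms(2,3) by (simp add: inv_mult_group m_assoc)
  ultimately show ?thesis by simp
qed

text \<open>Fitting the Cantor set to the times at which the loop is at the origin makes every gap a single
  excursion from the origin or a rest at the origin.\<close>

lemma earring_loop_fit:
  assumes \<gamma>: "\<gamma> \<in> based_loops earring (0, 0)"
  obtains \<gamma>' where "homotopic_paths earring \<gamma> \<gamma>'" "\<And>t. t \<in> cantor_set \<Longrightarrow> \<gamma>' t = (0, 0)"
    "\<And>n l. l \<in> gap_starts n \<Longrightarrow> (\<forall>t\<in>{0..1}. on_gap n l \<gamma>' t = (0, 0)) \<or> (\<forall>t\<in>{0<..<1}. on_gap n l \<gamma>' t \<noteq> (0, 0))"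
proof -
  note G = based_loopsD[OF \<gamma>]
  define K where "K = {t \<in> {0..1}. \<gamma> t = (0, 0)}"
  have "closed K"
    unfolding K_def using G(1) by (intro continuous_closed_preimage_constant) (auto simp: path_def)
  then interpret closed_set_of_reals K by unfold_locales
  have K01: "0 \<in> K" "1 \<in> K" using G(3,4) by (auto simp: K_def pathstart_def pathfinish_def)
  note fit = K01 zero_le_one
  define \<gamma>' where "\<gamma>' = \<gamma> \<circ> fit 0 1"
  have "homotopic_paths earring \<gamma> \<gamma>'"
    using G(1,2) fit_continuous[OF fit] fit_range[OF fit] fit_ends
    by (intro homotopic_paths_reparametrize[where f = "fit 0 1"]) (auto simp: \<gamma>'_def)
  moreover have "\<gamma>' t = (0, 0)" if "t \<in> cantor_set" for t
    using fit_cantor[OF fit that] by (simp add: \<gamma>'_def K_def)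
  moreover have "(\<forall>t\<in>{0..1}. on_gap n l \<gamma>' t = (0, 0)) \<or> (\<forall>t\<in>{0<..<1}. on_gap n l \<gamma>' t \<noteq> (0, 0))"
    if l: "l \<in> gap_starts n" for n l
  proof -
    obtain p q where pq: "p \<in> K" "q \<in> K" "p \<le> q" "K \<inter> {p<..<q} = {}"
      and eq: "\<And>s. s \<in> {0..1} \<Longrightarrow> fit 0 1 (l + s / 3 ^ n) = p + s * (q - p)"
      using fit_gap[OF l fit] by blast
    have on: "on_gap n l \<gamma>' s = \<gamma> (p + s * (q - p))" if "s \<in> {0..1}" for s
      using eq[OF that] by (simp add: on_gap_def \<gamma>'_def)
    show ?thesis
    proof (cases "p = q")
      case True
      then show ?thesis using on pq(1) by (auto simp: K_def)
    next
      case False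
      have "\<gamma> (p + s * (q - p)) \<noteq> (0, 0)" if s: "s \<in> {0<..<1}" for s
      proof -
        have "0 < s * (q - p)" "s * (q - p) < 1 * (q - p)"
          using s False pq(3) by (auto intro!: mult_strict_right_mono)
        then have "p + s * (q - p) \<in> {p<..<q}" by simp
        moreover from this have "p + s * (q - p) \<in> {0..1}" using pq(1,2) by (auto simp: K_def)
        ultimately show ?thesis using pq(4) by (auto simp: K_def)
      qed
      then show ?thesis using on by auto
    qed
  qed
  ultimately show ?thesis by (rule that)
qed

text \<open>Every element of the fundamental group is the class of a lasso around a loop \<open>\<gamma>'\<close> in the earring that
  has on each gap of the Cantor set at most one excursion from the origin. The excursion lies in one
  circle \<open>C\<^sub>n\<close> and represents \<open>c_elt n\<close>, its inverse or \<open>1\<close>, for which \<open>a\<close> and \<open>b\<close> give the same coset by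
  hypothesis and by normality of \<open>H\<close>. Thus \<open>a \<circ> \<gamma>'\<close> and \<open>b \<circ> \<gamma>'\<close> differ by an element of \<open>H\<close> on each gap,
  hence also as a whole.\<close>

lemma closed_imp_transfinite_products:
  assumes closed: "closed_subgroup earring_plus earring_plus_base P_subgroup p_tau X x H"
    and x: "x \<in> X" and H: "subgroup H (fundamental_group X x)"
  shows "transfinite_products_rel X x H"
  unfolding transfinite_products_rel_def
proof (intro allI impI ballI, elim conjE)
  fix a b g
  assume a: "based_map earring_plus earring_plus_base X x a"
    and b: "based_map earring_plus earring_plus_base X x b"
    and whisker_eq: "\<forall>t\<in>{0..1}. a (whisker t) = b (whisker t)"
    and c: "\<forall>n\<ge>1. H #>\<^bsub>fundamental_group X x\<^esub> induced_hom X a (c_elt n)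
                = H #>\<^bsub>fundamental_group X x\<^esub> induced_hom X b (c_elt n)"
    and g: "g \<in> carrier (fundamental_group earring_plus earring_plus_base)"
  let ?G = "fundamental_group X x" and ?\<Pi> = "fundamental_group earring_plus earring_plus_base"
  let ?\<omega> = "a \<circ> whisker"
  have tail: "tail X x (a (0, 0)) ?\<omega>" using tail_image_map[OF tail_whisker a] .
  interpret tail X x "a (0, 0)" ?\<omega> by (rule tail)
  interpret w: tail earring_plus earring_plus_base "(0, 0)" whisker by (rule tail_whisker)
  interpret A: group_hom ?\<Pi> ?G "induced_hom X a" by unfold_locales (rule induced_hom_hom[OF a])
  interpret B: group_hom ?\<Pi> ?G "induced_hom X b" by unfold_locales (rule induced_hom_hom[OF b])
  have normal: "H \<lhd> ?G" using closed H x by (rule closed_subgroup_normal)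
  have ab0: "b (0, 0) = a (0, 0)" using bspec[OF whisker_eq, of 1] by (simp add: whisker_def)
  \<comment> \<open>\<open>same h\<close> says that the two maps send \<open>h\<close> to the same coset of \<open>H\<close>.\<close>
  define same where "same h \<longleftrightarrow> induced_hom X a h \<otimes>\<^bsub>?G\<^esub> inv\<^bsub>?G\<^esub> induced_hom X b h \<in> H" for h
  have plus: "p \<in> based_loops earring (0, 0) \<Longrightarrow> p \<in> based_loops earring_plus (0, 0)" for p
    using based_loops_mono[OF earring_subset_plus] by blast
  have image: "a \<circ> p \<in> based_loops X (a (0, 0))" "b \<circ> p \<in> based_loops X (a (0, 0))"
    if "p \<in> based_loops earring (0, 0)" for p
    using plus[OF that] a b ab0 by (auto intro!: based_loops_image simp: based_map_def)
  have same_iff: "same (whisker_class p) \<longleftrightarrow> lasso X ?\<omega> ((a \<circ> p) +++ reversepath (b \<circ> p)) \<in> H"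
    if p: "p \<in> based_loops earring (0, 0)" for p
  proof -
    have "induced_hom X a (whisker_class p) = lasso X ?\<omega> (a \<circ> p)"
      unfolding whisker_class_lasso by (rule induced_hom_lasso[OF tail_whisker a plus[OF p]])
    moreover have "induced_hom X b (whisker_class p) = lasso X (b \<circ> whisker) (b \<circ> p)"
      unfolding whisker_class_lasso by (rule induced_hom_lasso[OF tail_whisker b plus[OF p]])
    moreover have "lasso X (b \<circ> whisker) (b \<circ> p) = lasso X ?\<omega> (b \<circ> p)"
      using whisker_eq by (intro lasso_cong_on) auto
    ultimately show ?thesis using image[OF p] by (simp add: same_def lasso_join_reversepath)
  qed
  have same_c: "same (c_elt n)" if n: "n \<ge> 1" for n
  proof -
    have "c_elt n \<in> carrier ?\<Pi>"
      unfolding c_elt_def whisker_class_lasso by (intro w.lasso_carrier plus ell_loop n)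
    then show ?thesis
      using c n rcoset_eq_iff[OF G.is_group H A.hom_closed B.hom_closed] unfolding same_def by blast
  qed
  have same_one: "same \<one>\<^bsub>?\<Pi>\<^esub>" using subgroup.one_closed[OF H] by (simp add: same_def)
  have same_inv: "same (inv\<^bsub>?\<Pi>\<^esub> h)" if "h \<in> carrier ?\<Pi>" "same h" for h
    using G.normal_quotient_inverse[OF normal, of "induced_hom X a h" "induced_hom X b h"] that
    by (simp add: same_def)
  have same_excursion: "same (whisker_class \<kappa>)"
    if \<kappa>: "\<kappa> \<in> based_loops earring (0, 0)" and inner: "\<forall>t\<in>{0<..<1}. \<kappa> t \<noteq> (0, 0)" for \<kappa>
  proof -
    obtain n where n: "n \<ge> 1" and \<kappa>n: "\<kappa> \<in> based_loops (earring_circle n) (0, 0)"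
      using earring_excursion_in_circle[OF \<kappa>] inner by blast
    obtain q where q: "q \<in> {\<lambda>_. (0, 0), ell n, reversepath (ell n)}" "homotopic_paths (earring_circle n) \<kappa> q"
      using circle_excursion_homotopic[OF n \<kappa>n] inner by blast
    have "homotopic_paths earring_plus \<kappa> q"
      using q(2) earring_circle_subset[OF n] earring_subset_plus by (blast intro: homotopic_paths_subset)
    then have "whisker_class \<kappa> = whisker_class q"
      unfolding whisker_class_lasso using plus[OF \<kappa>] by (rule w.lasso_cong)
    moreover have "same (whisker_class q)"
      using q(1)
    proof (elim insertE emptyE)
      assume "q = (\<lambda>_. (0, 0))"
      then show ?thesis using same_one by (simp add: whisker_class_lasso w.lasso_const)
    next
      assume "q = ell n"
      then show ?thesis using same_c[OF n] by (simp add: c_elt_def)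
    next
      assume "q = reversepath (ell n)"
      then have "whisker_class q = inv\<^bsub>?\<Pi>\<^esub> c_elt n"
        using plus[OF ell_loop[OF n]] by (simp add: whisker_class_lasso c_elt_def w.lasso_reversepath)
      moreover have "c_elt n \<in> carrier ?\<Pi>"
        unfolding c_elt_def whisker_class_lasso by (intro w.lasso_carrier plus ell_loop n)
      ultimately show ?thesis using same_inv same_c[OF n] by simp
    qed
    ultimately show ?thesis by simp
  qed
  obtain \<gamma> where \<gamma>: "\<gamma> \<in> based_loops earring (0, 0)" "g = whisker_class \<gamma>"
    using g earring_plus_loop_deform by (auto simp: carrier_fundamental_group)
  obtain \<gamma>' where hom: "homotopic_paths earring \<gamma> \<gamma>'" and cantor: "\<And>t. t \<in> cantor_set \<Longrightarrow> \<gamma>' t = (0, 0)"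
    and gaps: "\<And>n l. l \<in> gap_starts n \<Longrightarrow>
      (\<forall>t\<in>{0..1}. on_gap n l \<gamma>' t = (0, 0)) \<or> (\<forall>t\<in>{0<..<1}. on_gap n l \<gamma>' t \<noteq> (0, 0))"
    using earring_loop_fit[OF \<gamma>(1)] by metis
  have \<gamma>': "\<gamma>' \<in> based_loops earring (0, 0)" using based_loops_homotopic[OF \<gamma>(1) hom] .
  have g': "g = whisker_class \<gamma>'"
    unfolding \<gamma>(2) whisker_class_lasso
    using plus[OF \<gamma>(1)] hom earring_subset_plus by (intro w.lasso_cong) (auto intro: homotopic_paths_subset)
  have "lasso X ?\<omega> ((a \<circ> \<gamma>') +++ reversepath (b \<circ> \<gamma>')) \<in> H"
    using closed H tail image(1)[OF \<gamma>'] _ image(2)[OF \<gamma>']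
  proof (rule closed_subgroup_gapwise)
    fix n l assume l: "l \<in> gap_starts n"
    let ?\<kappa> = "on_gap n l \<gamma>'"
    have \<kappa>: "?\<kappa> \<in> based_loops earring (0, 0)"
      using based_loopsD(1,2)[OF \<gamma>'] cantor by (intro on_gap_loop l)
    have on: "on_gap n l (d \<circ> \<gamma>') = d \<circ> ?\<kappa>" for d :: "real \<times> real \<Rightarrow> 'a"
      by (simp add: on_gap_def fun_eq_iff)
    show "lasso X ?\<omega> (on_gap n l (a \<circ> \<gamma>') +++ reversepath (on_gap n l (b \<circ> \<gamma>'))) \<in> H"
      unfolding on
    proof (cases "\<forall>t\<in>{0..1}. ?\<kappa> t = (0, 0)")
      case True
      then have "lasso X ?\<omega> ((a \<circ> ?\<kappa>) +++ reversepath (b \<circ> ?\<kappa>)) = \<one>\<^bsub>?G\<^esub>"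
        using ab0 by (intro lasso_join_reversepath_self[OF tail] image \<kappa>) auto
      then show "lasso X ?\<omega> ((a \<circ> ?\<kappa>) +++ reversepath (b \<circ> ?\<kappa>)) \<in> H"
        using subgroup.one_closed[OF H] by simp
    next
      case False
      then show "lasso X ?\<omega> ((a \<circ> ?\<kappa>) +++ reversepath (b \<circ> ?\<kappa>)) \<in> H"
        using gaps[OF l] same_excursion[OF \<kappa>] same_iff[OF \<kappa>] by blast
    qed
  qed (use cantor ab0 in auto)
  then have "same g" unfolding g' using same_iff[OF \<gamma>'] by simp
  then show "H #>\<^bsub>?G\<^esub> induced_hom X a g = H #>\<^bsub>?G\<^esub> induced_hom X b g"
    using g by (simp add: same_def rcoset_eq_iff[OF G.is_group H])
qed

theorem proposition3p21:
  fixes X :: "'a::topological_space set" and x0 :: 'a and H :: "(real \<Rightarrow> 'a) set set"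
  assumes "path_connected X" and "x0 \<in> X"
    and "subgroup H (fundamental_group X x0)"
  shows "transfinite_products_rel X x0 H \<longleftrightarrow>
         closed_subgroup earring_plus earring_plus_base P_subgroup p_tau X x0 H"
  using transfinite_products_imp_closed[OF _ assms(2,3)] closed_imp_transfinite_products[OF _ assms(2,3)]
  by blast

end
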